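(* Let $P$ be a $d\times d$ symmetric matrix with non-negative diagonal entries and $c\in\mathbb{R}^d$, and assume that $\|Q(c,P)\|_\infty\le1$ (largest absolute value of an entry). Let $W^*$ be an $\epsilon$-optimal solution to $\mathrm{SDP}(c,P)$. Suppose that there is a threshold value $T>0$, which is a function of the input $P$ and $c$, such that $\sigma/T\to0$ as $(\sigma,T)\to\infty$. Then Algorithm 1 with input $W^*$, a fixed constant $0<C\le1$, and $T$, is an asymptotic $(1/T^2)$-approximation algorithm for (SBQP) in expectation. That is, its output $\bar x$ satisfies $$\mathbb{E}\big(\bar x^\top P\bar x-2c^\top\bar x\big)\le\frac1{T^2}\Big[(x^* )^\top Px^*-2c^\top x^*+\epsilon\Big]+o(1)\qquad\text{as }(\sigma,T)\to\infty,$$ where $x^*$ is an optimal solution to (SBQP). Furthermore, with high probability, $\bar x$ is feasible to (SBQP). In particular, if $\sigma/\sqrt{\log d}\to0$, then Algorithm 1 with input $(W^*,C,T)$, $T=\sqrt{\log d}$, is an asymptotic $(1/\log d)$-approximation algorithm for (SBQP) in expectation (in the same sense).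
   Context: $\sigma\le d$ is a positive integer. (SBQP): minimize $x^\top Px-2c^\top x$ over $x\in\{0,\pm1\}^d$ subject to $\|x\|_0\le\sigma$, where $\|x\|_0$ is the number of nonzero entries of $x$. $Q(c,P):=\begin{pmatrix}0&-c^\top\\-c&P\end{pmatrix}\in\mathbb{R}^{(1+d)\times(1+d)}$. $\mathrm{SDP}(c,P)$: minimize $\operatorname{tr}(Q(c,P)W)$ over symmetric positive semidefinite $W\in\mathbb{R}^{(1+d)\times(1+d)}$ subject to $W_{11}=1$, $\operatorname{tr}(W_x)\le\sigma$, $1_d^\top|W_x|1_d\le\sigma^2$, $\operatorname{diag}(W_x)\le 1_d$ (entrywise). Here $W_x$ is the $d\times d$ matrix obtained from $W$ by deleting its first row and column, $|W_x|$ is the entrywise absolute value, and $1_d$ is the all-ones vector. An $\epsilon$-optimal solution is a feasible $W^*$ whose objective value is at most the optimal value plus $\epsilon$. Let $h(x)=1$ if $x>1$, $h(x)=x$ if $-1\le x\le1$, $h(x)=-1$ if $x<-1$. Algorithm 1 (input: $W^*$, $0<C\le1$, $T>0$; output $\bar x\in\{0,\pm1\}^d$): 1. Let $U=(u_0,u_1,\dots,u_d)=\sqrt{W^*}$ (positive semidefinite square root, with columns $u_0,\dots,u_d\in\mathbb{R}^{d+1}$). 2. Generate $g\sim\mathcal{N}(0_{d+1},I_{d+1})$. 3. Set $z_0=u_0^\top g$, $y_0=h(z_0/T)$; sample $x_0=1$ with probability $(1+y_0)/2$ and $x_0=-1$ with probability $(1-y_0)/2$. 4. For $k=1,\dots,d$: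 set $p_k=\frac23\|u_k\|_2^2$ if $\|u_k\|_2\ge C$ and $p_k=0$ otherwise; sample $\epsilon_k=1$ with probability $p_k$ and $\epsilon_k=0$ with probability $1-p_k$ (independently over $k$ and of $g$); set $\tilde u_k=\epsilon_ku_k/p_k$ (with $0/0=0$), $z_k=\tilde u_k^\top g$, $y_k=h(z_k/T)$; sample $x_k=\operatorname{sign}(y_k)$ with probability $|y_k|$ and $x_k=0$ with probability $1-|y_k|$. (The samplings of $x_0,\dots,x_d$ are independent given $y_0,\dots,y_d$.) 5. Return $\bar x=\operatorname{sign}(x_0)\cdot(x_1,\dots,x_d)^\top$. "With high probability" means with probability at least $1-\mathcal{O}(1/d)-\mathcal{O}(\exp(-c_0\sigma))$ for some absolute constant $c_0>0$. The limit statements concern sequences of instances along which $\sigma\to\infty$ and $T\to\infty$ with $C$ fixed. *)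

theory Defs
  imports
    "HOL-Probability.Probability"
    "HOL-Library.Landau_Symbols"
    "Jordan_Normal_Form.Determinant"
begin

(* The dimension varies along a sequence of instances, so vectors and matrices are the
   dynamically sized ones of Jordan_Normal_Form; HOL-Analysis notation that clashes is removed. *)
hide_const (open) Finite_Cartesian_Product.vec Finite_Cartesian_Product.row
  Finite_Cartesian_Product.column Finite_Cartesian_Product.transpose Determinants.trace
no_notation Finite_Cartesian_Product.vec_nth (infixl \<open>$\<close> 90)
no_notation Inner_Product.real_inner_class.inner (infix \<open>\<bullet>\<close> 70)

definition mat_trace :: "real mat \<Rightarrow> real" where
  "mat_trace A = (\<Sum>i<dim_row A. A $$ (i, i))"

definition l2_norm_vec :: "real vec \<Rightarrow> real" where
  "l2_norm_vec v = sqrt (v \<bullet> v)"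

definition max_abs_entry :: "real mat \<Rightarrow> real" where
  "max_abs_entry A = Max (abs ` elements_mat A)"

definition ones_vec :: "nat \<Rightarrow> real vec" where
  "ones_vec n = vec n (\<lambda>_. 1)"

definition psd_mat :: "real mat \<Rightarrow> bool" where
  "psd_mat A \<longleftrightarrow> square_mat A \<and> A\<^sup>T = A \<and>
     (\<forall>v\<in>carrier_vec (dim_row A). 0 \<le> v \<bullet> (A *\<^sub>v v))"

definition psd_sqrt :: "real mat \<Rightarrow> real mat" where
  "psd_sqrt A = (THE U. psd_mat U \<and> U * U = A)"


subsection \<open>The sparse binary quadratic program\<close>

definition num_nonzero :: "real vec \<Rightarrow> nat" where
  "num_nonzero x = card {i. i < dim_vec x \<and> x $ i \<noteq> 0}"

definition sbqp_objective :: "real mat \<Rightarrow> real vec \<Rightarrow> real vec \<Rightarrow> real" where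
  "sbqp_objective P c x = x \<bullet> (P *\<^sub>v x) - 2 * (c \<bullet> x)"

definition sbqp_feasible :: "nat \<Rightarrow> nat \<Rightarrow> real vec set" where
  "sbqp_feasible d \<sigma> =
     {x \<in> carrier_vec d. (\<forall>i<d. x $ i \<in> {-1, 0, 1}) \<and> num_nonzero x \<le> \<sigma>}"

definition sbqp_optimal :: "nat \<Rightarrow> nat \<Rightarrow> real mat \<Rightarrow> real vec \<Rightarrow> real vec \<Rightarrow> bool" where
  "sbqp_optimal d \<sigma> P c x \<longleftrightarrow> x \<in> sbqp_feasible d \<sigma> \<and>
     (\<forall>y\<in>sbqp_feasible d \<sigma>. sbqp_objective P c x \<le> sbqp_objective P c y)"


subsection \<open>The semidefinite relaxation\<close>

definition Q_mat :: "real vec \<Rightarrow> real mat \<Rightarrow> real mat" where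
  "Q_mat c P = four_block_mat (0\<^sub>m 1 1) (mat_of_rows (dim_vec c) [- c])
                              (mat_of_cols (dim_vec c) [- c]) P"

abbreviation W_sub :: "real mat \<Rightarrow> real mat" where
  "W_sub W \<equiv> mat_delete W 0 0"

definition sdp_objective :: "real vec \<Rightarrow> real mat \<Rightarrow> real mat \<Rightarrow> real" where
  "sdp_objective c P W = mat_trace (Q_mat c P * W)"

definition sdp_feasible :: "nat \<Rightarrow> nat \<Rightarrow> real mat set" where
  "sdp_feasible d \<sigma> =
     {W \<in> carrier_mat (1 + d) (1 + d).
        psd_mat W \<and> W $$ (0, 0) = 1 \<and>
        mat_trace (W_sub W) \<le> real \<sigma> \<and>
        ones_vec d \<bullet> (map_mat abs (W_sub W) *\<^sub>v ones_vec d) \<le> (real \<sigma>)\<^sup>2 \<and>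
        (\<forall>i<d. W_sub W $$ (i, i) \<le> 1)}"

definition sdp_value :: "nat \<Rightarrow> nat \<Rightarrow> real vec \<Rightarrow> real mat \<Rightarrow> real" where
  "sdp_value d \<sigma> c P = (INF W\<in>sdp_feasible d \<sigma>. sdp_objective c P W)"

definition sdp_eps_optimal ::
    "nat \<Rightarrow> nat \<Rightarrow> real vec \<Rightarrow> real mat \<Rightarrow> real \<Rightarrow> real mat \<Rightarrow> bool" where
  "sdp_eps_optimal d \<sigma> c P \<epsilon> W \<longleftrightarrow> W \<in> sdp_feasible d \<sigma> \<and>
     sdp_objective c P W \<le> sdp_value d \<sigma> c P + \<epsilon>"


subsection \<open>The rounding algorithm\<close>

definition clip :: "real \<Rightarrow> real" where
  "clip x = (if x > 1 then 1 else if x < -1 then -1 else x)"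

definition std_gaussian :: "nat \<Rightarrow> (nat \<Rightarrow> real) measure" where
  "std_gaussian n = (\<Pi>\<^sub>M i\<in>{..<n}. density lborel (\<lambda>x. ennreal (std_normal_density x)))"

definition keep_prob :: "real \<Rightarrow> real vec \<Rightarrow> real" where
  "keep_prob C u = (if l2_norm_vec u \<ge> C then 2 / 3 * (l2_norm_vec u)\<^sup>2 else 0)"

definition sample_sign :: "real \<Rightarrow> real pmf" where
  "sample_sign y = map_pmf (\<lambda>b. if b then 1 else -1) (bernoulli_pmf ((1 + y) / 2))"

definition sample_entry :: "real \<Rightarrow> real pmf" where
  "sample_entry y = map_pmf (\<lambda>b. if b then sgn y else 0) (bernoulli_pmf \<bar>y\<bar>)"

(* Law of the output conditionally on the Gaussian vector g. *)
definition round_pmf ::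
    "nat \<Rightarrow> real mat \<Rightarrow> real \<Rightarrow> real \<Rightarrow> real vec \<Rightarrow> real vec pmf" where
  "round_pmf d U C T g = do {
     let p = (\<lambda>k. keep_prob C (col U k));
     \<epsilon> \<leftarrow> Pi_pmf {1..d} 0 (\<lambda>k. map_pmf of_bool (bernoulli_pmf (p k)));
     let y = (\<lambda>k. clip (((\<epsilon> k / p k) \<cdot>\<^sub>v col U k) \<bullet> g / T));
     x0 \<leftarrow> sample_sign (clip (col U 0 \<bullet> g / T));
     x \<leftarrow> Pi_pmf {1..d} 0 (\<lambda>k. sample_entry (y k));
     return_pmf (sgn x0 \<cdot>\<^sub>v vec d (\<lambda>i. x (Suc i)))
   }"

(* Law of the output; the sigma-algebra is the full power set. *)
definition algorithm1 :: "real mat \<Rightarrow> real \<Rightarrow> real \<Rightarrow> real vec measure" where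
  "algorithm1 W C T = (let n = dim_row W in
     std_gaussian n \<bind>
       (\<lambda>g. measure_pmf (round_pmf (n - 1) (psd_sqrt W) C T (vec n g))))"


subsection \<open>Instances and asymptotic guarantees\<close>

definition sbqp_instance :: "nat \<Rightarrow> nat \<Rightarrow> real mat \<Rightarrow> real vec \<Rightarrow> bool" where
  "sbqp_instance d \<sigma> P c \<longleftrightarrow> 0 < \<sigma> \<and> \<sigma> \<le> d \<and>
     P \<in> carrier_mat d d \<and> P\<^sup>T = P \<and> (\<forall>i<d. 0 \<le> P $$ (i, i)) \<and>
     c \<in> carrier_vec d \<and> max_abs_entry (Q_mat c P) \<le> 1"

definition asymp_approx_in_expectation ::
    "(nat \<Rightarrow> real) \<Rightarrow> (nat \<Rightarrow> real mat) \<Rightarrow> (nat \<Rightarrow> real vec) \<Rightarrow> (nat \<Rightarrow> real) \<Rightarrow>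
     (nat \<Rightarrow> real vec) \<Rightarrow> (nat \<Rightarrow> real vec measure) \<Rightarrow> bool" where
  "asymp_approx_in_expectation \<alpha> P c \<epsilon> xopt out \<longleftrightarrow>
     (\<exists>r \<in> o(\<lambda>_. 1). \<forall>n.
        (\<integral>x. sbqp_objective (P n) (c n) x \<partial>out n)
          \<le> \<alpha> n * (sbqp_objective (P n) (c n) (xopt n) + \<epsilon> n) + r n)"

end

theory Submission
  imports Defs
begin

text \<open>
  Since \<open>|P\<^sub>i\<^sub>j|, |c\<^sub>i| \<le> 1\<close>, a ternary vector with \<open>N\<close> nonzero entries has objective at most
  \<open>N\<^sup>2 + 2 N\<close> in absolute value, so the optimal value divided by \<open>T\<^sup>2\<close> is \<open>O((\<sigma> / T)\<^sup>2)\<close> and it suffices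
  that the expected objective of the output vanishes. Given \<open>g\<close>, the entries of the output are
  independent up to the common sign, and the \<open>k\<close>-th one is nonzero with probability at most
  \<open>|u\<^sub>k\<^sup>T g| / T\<close> if \<open>\<parallel>u\<^sub>k\<parallel> \<ge> C\<close> and \<open>0\<close> otherwise. The trace constraint leaves at most \<open>\<sigma> / C\<^sup>2\<close> such \<open>k\<close>,
  hence by Cauchy-Schwarz the second moment of \<open>N\<close> is governed by \<open>\<sigma> / (C T)\<close>. Feasibility
  is a Chernoff bound: the \<open>k\<close>-th entry is nonzero with probability at most
  \<open>p\<^sub>k \<le> 2 / 3 W\<^sub>k\<^sub>k\<close>, whatever \<open>g\<close> is, and these sum to at most \<open>2 \<sigma> / 3\<close>.
\<close>

subsection \<open>The positive semidefinite square root\<close>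

lemma psd_matD:
  assumes "psd_mat A" "A \<in> carrier_mat n n"
  shows "A\<^sup>T = A" "v \<in> carrier_vec n \<Longrightarrow> 0 \<le> v \<bullet> (A *\<^sub>v v)"
  using assms by (auto simp: psd_mat_def)

lemma psd_matI:
  assumes "A \<in> carrier_mat n n" "A\<^sup>T = A" "\<And>v. v \<in> carrier_vec n \<Longrightarrow> 0 \<le> v \<bullet> (A *\<^sub>v v)"
  shows "psd_mat A"
  using assms by (auto simp: psd_mat_def)

lemma scalar_prod_real_eq_0D:
  assumes "v \<in> carrier_vec n" "v \<bullet> v = (0::real)"
  shows "v = 0\<^sub>v n"
proof -
  have "(\<Sum>i\<in>{0..<n}. v $ i * v $ i) = 0"
    using assms by (simp add: scalar_prod_def)
  then have "\<forall>i\<in>{0..<n}. v $ i * v $ i = 0"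
    by (subst (asm) sum_nonneg_eq_0_iff) auto
  then show ?thesis using assms(1) by (intro eq_vecI) auto
qed

lemma scalar_prod_real_self_nonneg: "0 \<le> v \<bullet> (v::real vec)"
  by (auto simp: scalar_prod_def intro!: sum_nonneg)

text \<open>Cauchy-Schwarz in its arithmetic-mean form. It loses nothing in the uses below, where
  both squared norms are bounded by the same quantity.\<close>

lemma abs_scalar_prod_le:
  assumes "v \<in> carrier_vec n" "w \<in> carrier_vec n"
  shows "\<bar>v \<bullet> w\<bar> \<le> (v \<bullet> v + w \<bullet> w) / (2::real)"
proof -
  have "\<bar>v \<bullet> w\<bar> \<le> (\<Sum>i\<in>{0..<n}. \<bar>v $ i * w $ i\<bar>)"
    using assms by (auto simp: scalar_prod_def intro: order_trans[OF sum_abs])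
  also have "\<dots> \<le> (\<Sum>i\<in>{0..<n}. (v $ i * v $ i + w $ i * w $ i) / 2)"
  proof (rule sum_mono)
    fix i
    show "\<bar>v $ i * w $ i\<bar> \<le> (v $ i * v $ i + w $ i * w $ i) / 2"
      using zero_le_square[of "v $ i - w $ i"] zero_le_square[of "v $ i + w $ i"]
      by (simp add: algebra_simps abs_le_iff)
  qed
  also have "\<dots> = (v \<bullet> v + w \<bullet> w) / 2"
    using assms by (simp add: scalar_prod_def sum.distrib sum_divide_distrib[symmetric])
  finally show ?thesis .
qed

lemma symmetric_scalar_prod:
  assumes "A \<in> carrier_mat n n" "A\<^sup>T = A" "x \<in> carrier_vec n" "y \<in> carrier_vec n"
  shows "(A *\<^sub>v x) \<bullet> y = x \<bullet> (A *\<^sub>v (y :: real vec))"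
  using transpose_vec_mult_scalar[of A n n y x] assms by simp

lemma symmetric_mat_entry:
  assumes "A \<in> carrier_mat n n" "A\<^sup>T = A" "i < n" "j < n"
  shows "A $$ (i, j) = A $$ (j, i)"
  using assms by (metis carrier_matD index_transpose_mat(1))

lemma smult_mat_mult_vec:
  assumes "A \<in> carrier_mat n n" "v \<in> carrier_vec n"
  shows "(k \<cdot>\<^sub>m A) *\<^sub>v v = k \<cdot>\<^sub>v (A *\<^sub>v (v :: real vec))"
  using assms by (intro eq_vecI) auto

lemma mult_mat_entry:
  assumes "A \<in> carrier_mat n n" "B \<in> carrier_mat n n" "i < n" "j < n"
  shows "(A * B) $$ (i, j) = (\<Sum>l\<in>{0..<n}. A $$ (i, l) * B $$ (l, j))"
  using assms by (simp add: scalar_prod_def)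

section \<open>Uniqueness among commuting square roots\<close>

lemma mat_eqI_mult_vec:
  assumes A: "A \<in> carrier_mat n n" and B: "B \<in> carrier_mat n n"
    and eq: "\<And>v. v \<in> carrier_vec n \<Longrightarrow> A *\<^sub>v v = B *\<^sub>v (v::real vec)"
  shows "A = B"
proof (rule eq_matI)
  fix i j assume ij: "i < dim_row B" "j < dim_col B"
  have "(A *\<^sub>v unit_vec n j) $ i = (B *\<^sub>v unit_vec n j) $ i"
    by (simp add: eq)
  then show "A $$ (i, j) = B $$ (i, j)" using A B ij by simp
qed (use A B in auto)

text \<open>A zero of a nonnegative form is a minimum. Moving from \<open>w\<close> by
  \<open>- s z\<close> with \<open>z = A w\<close> gives a quadratic in \<open>s\<close> without
  constant term, and nonnegativity for all \<open>s\<close> forces its linear coefficient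
  \<open>- 2 p\<close> to vanish.\<close>

lemma psd_mat_form_eq_0D:
  assumes A: "A \<in> carrier_mat n n" "psd_mat A" and w: "w \<in> carrier_vec n"
    and 0: "w \<bullet> (A *\<^sub>v w) = 0"
  shows "A *\<^sub>v w = 0\<^sub>v n"
proof -
  define z where "z = A *\<^sub>v w"
  define p where "p = z \<bullet> z"
  define q where "q = z \<bullet> (A *\<^sub>v z)"
  have z: "z \<in> carrier_vec n" and Az: "A *\<^sub>v z \<in> carrier_vec n"
    using A w by (auto simp: z_def)
  have q: "q \<ge> 0" using psd_matD(2)[OF A(2,1) z] by (simp add: q_def)
  have wAz: "w \<bullet> (A *\<^sub>v z) = p"
    using symmetric_scalar_prod[OF A(1) psd_matD(1)[OF A(2,1)] w z] by (simp add: p_def z_def)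
  have ineq: "0 \<le> s * s * q - 2 * s * p" for s
  proof -
    have sz: "s \<cdot>\<^sub>v z \<in> carrier_vec n" using z by simp
    have "A *\<^sub>v (w - s \<cdot>\<^sub>v z) = z - s \<cdot>\<^sub>v (A *\<^sub>v z)"
      using A(1) w z by (simp add: mult_minus_distrib_mat_vec mult_mat_vec z_def)
    then have "(w - s \<cdot>\<^sub>v z) \<bullet> (A *\<^sub>v (w - s \<cdot>\<^sub>v z)) = (w - s \<cdot>\<^sub>v z) \<bullet> (z - s \<cdot>\<^sub>v (A *\<^sub>v z))"
      by simp
    also have "\<dots> = w \<bullet> z - s * (w \<bullet> (A *\<^sub>v z)) - (s * p - s * (s * q))"
      using w z Az sz
      by (simp add: minus_scalar_prod_distrib[of _ n] scalar_prod_minus_distrib[of _ n]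
          p_def q_def)
    also have "\<dots> = s * s * q - 2 * s * p"
      using 0 wAz by (simp add: z_def)
    finally show ?thesis
      using psd_matD(2)[OF A(2,1), of "w - s \<cdot>\<^sub>v z"] w z by simp
  qed
  \<comment> \<open>At this \<open>t\<close> the quadratic in \<open>ineq\<close> equals
    \<open>- t^2 (q + 2)\<close>; the summand 1 keeps the denominator positive when
    \<open>q = 0\<close>.\<close>
  define t where "t = p / (1 + q)"
  have p: "p = t * (1 + q)" using q by (simp add: t_def)
  have "t\<^sup>2 * (q + 2) \<le> 0"
    using ineq[of t] by (simp add: p power2_eq_square algebra_simps)
  then have "t\<^sup>2 \<le> 0" using q by (simp add: mult_le_0_iff)
  then have "p = 0" by (simp add: p)
  then show ?thesis using scalar_prod_real_eq_0D[OF z] by (simp add: p_def z_def)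
qed

text \<open>Commutation turns \<open>U U = V V\<close> into \<open>(U + V) (U - V) = 0\<close>. With
  \<open>w = (U - V) v\<close>, the forms of \<open>U\<close> and \<open>V\<close> at
  \<open>w\<close> are nonnegative with sum 0, so both matrices annihilate \<open>w\<close>, and
  then \<open>w . w = v . (U - V) w = 0\<close>.\<close>

lemma psd_mat_square_inj_commuting:
  assumes U: "U \<in> carrier_mat n n" "psd_mat U" and V: "V \<in> carrier_mat n n" "psd_mat V"
    and comm: "U * V = V * U" and sq: "U * U = V * V"
  shows "U = V"
proof (rule mat_eqI_mult_vec[OF U(1) V(1)])
  fix v :: "real vec" assume v: "v \<in> carrier_vec n"
  define w where "w = U *\<^sub>v v - V *\<^sub>v v"
  have Uv: "U *\<^sub>v v \<in> carrier_vec n" and Vv: "V *\<^sub>v v \<in> carrier_vec n" using U V v by auto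
  then have w: "w \<in> carrier_vec n" by (simp add: w_def)
  have Uw: "U *\<^sub>v w \<in> carrier_vec n" and Vw: "V *\<^sub>v w \<in> carrier_vec n" using U V w by auto
  have UVv: "U *\<^sub>v (V *\<^sub>v v) = V *\<^sub>v (U *\<^sub>v v)"
    using comm U V v by (metis assoc_mult_mat_vec)
  have UUv: "U *\<^sub>v (U *\<^sub>v v) = V *\<^sub>v (V *\<^sub>v v)"
    using sq U V v by (metis assoc_mult_mat_vec)
  have c: "V *\<^sub>v (V *\<^sub>v v) \<in> carrier_vec n" "V *\<^sub>v (U *\<^sub>v v) \<in> carrier_vec n" using U V v by auto
  have Uw': "U *\<^sub>v w = V *\<^sub>v (V *\<^sub>v v) - V *\<^sub>v (U *\<^sub>v v)"
    using U V v Uv Vv by (simp add: w_def mult_minus_distrib_mat_vec UVv UUv)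
  have Vw': "V *\<^sub>v w = V *\<^sub>v (U *\<^sub>v v) - V *\<^sub>v (V *\<^sub>v v)"
    using U V v Uv Vv by (simp add: w_def mult_minus_distrib_mat_vec)
  have "w \<bullet> (U *\<^sub>v w) + w \<bullet> (V *\<^sub>v w) = 0"
    using w c by (simp add: Uw' Vw' scalar_prod_minus_distrib[of _ n])
  moreover have "w \<bullet> (U *\<^sub>v w) \<ge> 0" "w \<bullet> (V *\<^sub>v w) \<ge> 0"
    using psd_matD(2) U V w by blast+
  ultimately have "w \<bullet> (U *\<^sub>v w) = 0" "w \<bullet> (V *\<^sub>v w) = 0" by linarith+
  then have 0: "U *\<^sub>v w = 0\<^sub>v n" "V *\<^sub>v w = 0\<^sub>v n"
    using psd_mat_form_eq_0D U V w by blast+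
  have "w \<bullet> w = (U *\<^sub>v v) \<bullet> w - (V *\<^sub>v v) \<bullet> w"
    using minus_scalar_prod_distrib[OF Uv Vv w] by (simp add: w_def)
  also have "\<dots> = v \<bullet> (U *\<^sub>v w) - v \<bullet> (V *\<^sub>v w)"
    using symmetric_scalar_prod[OF U(1) psd_matD(1)[OF U(2,1)] v w]
      symmetric_scalar_prod[OF V(1) psd_matD(1)[OF V(2,1)] v w] by simp
  also have "\<dots> = 0" using v by (simp add: 0)
  finally have "w = 0\<^sub>v n" using scalar_prod_real_eq_0D[OF w] by blast
  then have "(U *\<^sub>v v) $ i = (V *\<^sub>v v) $ i" if "i < n" for i
    using that U V v index_minus_vec(1)[of i "V *\<^sub>v v" "U *\<^sub>v v"] by (simp add: w_def)
  then show "U *\<^sub>v v = V *\<^sub>v v" using Uv Vv by (metis carrier_vecD eq_vecI)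
qed

text \<open>The Taylor coefficients of \<open>sqrt (1 - x)\<close>.\<close>

definition sqrt_coeff :: "nat \<Rightarrow> real" where
  "sqrt_coeff k = pochhammer (- 1 / 2) k / fact k"

lemma sqrt_coeff_gbinomial: "sqrt_coeff k = (- 1) ^ k * (1 / 2 gchoose k)"
  by (simp add: sqrt_coeff_def gbinomial_pochhammer mult.assoc[symmetric] power_mult_distrib[symmetric])

lemma sqrt_coeff_0: "sqrt_coeff 0 = 1"
  by (simp add: sqrt_coeff_def)

lemma sqrt_coeff_Suc_nonpos: "sqrt_coeff (Suc k) \<le> 0"
proof -
  have "pochhammer (1 / 2 :: real) k \<ge> 0" by (rule pochhammer_nonneg) simp
  then show ?thesis
    by (simp add: sqrt_coeff_def pochhammer_rec divide_nonpos_nonneg)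
qed

text \<open>The alternating partial sums of the binomial series for exponent 1/2 telescope to
  \<open>(- 1) ^ m\<close> times the binomial coefficient of -1/2 over \<open>m\<close>, which is a
  quotient of positive numbers.\<close>

lemma sqrt_coeff_partial_sum_nonneg: "0 \<le> (\<Sum>k\<le>m. sqrt_coeff k)"
proof -
  have "(\<Sum>k\<le>m. sqrt_coeff k) = (\<Sum>k\<le>m. (1 / 2 gchoose k) * (- 1) ^ k)"
    by (simp add: sqrt_coeff_gbinomial mult.commute)
  also have "\<dots> = pochhammer (1 / 2) m / fact m"
    unfolding gbinomial_sum_lower_neg
    by (simp add: gbinomial_pochhammer mult.assoc[symmetric] power_mult_distrib[symmetric])
  also have "\<dots> \<ge> 0" using pochhammer_nonneg[of "1/2::real" m] by simp
  finally show ?thesis .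
qed

text \<open>All coefficients after the first are nonpositive, so their absolute sum is 1 minus a
  nonnegative partial sum. The bound gives absolute convergence up to norm 1, and the exact constant
  1 yields positivity in \<open>sqrt_series_psd\<close>.\<close>

lemma sqrt_coeff_Suc_sum_le: "(\<Sum>k<m. \<bar>sqrt_coeff (Suc k)\<bar>) \<le> 1"
proof -
  have "(\<Sum>k\<le>m. sqrt_coeff k) = sqrt_coeff 0 + (\<Sum>k<m. sqrt_coeff (Suc k))"
    by (simp add: sum.atMost_shift)
  then have "(\<Sum>k<m. - sqrt_coeff (Suc k)) \<le> 1"
    using sqrt_coeff_partial_sum_nonneg[of m] by (simp add: sqrt_coeff_0 sum_negf)
  then show ?thesis using sqrt_coeff_Suc_nonpos by (simp add: abs_of_nonpos)
qed

lemma summable_abs_sqrt_coeff_Suc: "summable (\<lambda>k. \<bar>sqrt_coeff (Suc k)\<bar>)"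
  using sqrt_coeff_Suc_sum_le by (intro summableI_nonneg_bounded) auto

lemma summable_abs_sqrt_coeff: "summable (\<lambda>k. \<bar>sqrt_coeff k\<bar>)"
  using summable_abs_sqrt_coeff_Suc by (subst (asm) summable_Suc_iff)

text \<open>The coefficients of \<open>sqrt (1 - x)\<close> squared, that is of
  \<open>1 - x\<close>; this is the Vandermonde identity for 1/2 + 1/2 = 1.\<close>

lemma sqrt_coeff_convolution:
  "(\<Sum>i\<le>k. sqrt_coeff i * sqrt_coeff (k - i)) = (if k = 0 then 1 else if k = 1 then - 1 else 0)"
proof -
  have "(\<Sum>i\<le>k. sqrt_coeff i * sqrt_coeff (k - i)) =
      (\<Sum>i\<in>{0..k}. (- 1) ^ k * ((1 / 2 gchoose i) * (1 / 2 gchoose (k - i))))"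
    unfolding atMost_atLeast0
  proof (rule sum.cong[OF refl])
    fix i assume "i \<in> {0..k}"
    then have "(- 1 :: real) ^ k = (- 1) ^ i * (- 1) ^ (k - i)"
      by (simp add: power_add[symmetric])
    then show "sqrt_coeff i * sqrt_coeff (k - i) =
        (- 1) ^ k * ((1 / 2 gchoose i) * (1 / 2 gchoose (k - i)))"
      by (simp add: sqrt_coeff_gbinomial)
  qed
  also have "\<dots> = (- 1) ^ k * (1 gchoose k)"
    by (simp add: sum_distrib_left[symmetric] gbinomial_Vandermonde)
  also have "(1 gchoose k) = (of_nat (1 choose k) :: real)"
    using binomial_gbinomial[of 1 k, where 'a=real] by simp
  also have "(- 1) ^ k * \<dots> = (if k = 0 then 1 else if k = 1 then - 1 else 0)"
    by (auto simp: binomial_eq_0)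
  finally show ?thesis .
qed

section \<open>The power series of sqrt (1 - B) for 0 <= B <= 1\<close>

locale psd_contraction =
  fixes n :: nat and B :: "real mat"
  assumes carrier: "B \<in> carrier_mat n n" and psd: "psd_mat B"
    and form_le: "v \<in> carrier_vec n \<Longrightarrow> v \<bullet> (B *\<^sub>v v) \<le> v \<bullet> v"
begin

lemma pow_carrier: "B ^\<^sub>m k \<in> carrier_mat n n"
  using carrier by (rule pow_carrier_mat)

lemma pow_Suc: "B ^\<^sub>m Suc k = B * B ^\<^sub>m k"
proof (induction k)
  case 0
  then show ?case using carrier by simp
next
  case (Suc k)
  then show ?case
    using assoc_mult_mat[OF carrier pow_carrier[of k] carrier] by simp
qed

lemma pow_add: "B ^\<^sub>m (j + k) = B ^\<^sub>m j * B ^\<^sub>m k"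
proof (induction j)
  case 0
  then show ?case using carrier pow_carrier[of k] by simp
next
  case (Suc j)
  have "B ^\<^sub>m (Suc j + k) = B * (B ^\<^sub>m j * B ^\<^sub>m k)" by (simp only: add_Suc pow_Suc Suc)
  also have "\<dots> = B ^\<^sub>m Suc j * B ^\<^sub>m k"
    unfolding pow_Suc using assoc_mult_mat[OF carrier pow_carrier[of j] pow_carrier[of k]] by simp
  finally show ?case .
qed

text \<open>This is \<open>B - B\<^sup>2 = B (1 - B) B + (1 - B) B (1 - B) \<ge> 0\<close>, with \<open>w = B v\<close> and \<open>z = (1 - B) v\<close>.\<close>

lemma norm_mult_le:
  assumes v: "v \<in> carrier_vec n"
  shows "(B *\<^sub>v v) \<bullet> (B *\<^sub>v v) \<le> v \<bullet> v"
proof -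
  define w where "w = B *\<^sub>v v"
  define z where "z = v - w"
  have w: "w \<in> carrier_vec n" and z: "z \<in> carrier_vec n"
    using carrier v by (auto simp: w_def z_def)
  have Bw: "B *\<^sub>v w \<in> carrier_vec n" and Bz: "B *\<^sub>v z \<in> carrier_vec n"
    using carrier w z by auto
  have Bz': "B *\<^sub>v z = w - B *\<^sub>v w"
    using carrier v w by (simp add: z_def mult_minus_distrib_mat_vec w_def)
  have zw: "v \<bullet> w - w \<bullet> w = z \<bullet> w"
    using minus_scalar_prod_distrib[OF v w w] by (simp add: z_def)
  have "w = B *\<^sub>v z + B *\<^sub>v w"
    using w Bw carrier by (intro eq_vecI) (auto simp: Bz' simp del: index_mult_mat_vec)
  then have "z \<bullet> w = z \<bullet> (B *\<^sub>v z) + z \<bullet> (B *\<^sub>v w)"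
    using scalar_prod_add_distrib[OF z Bz Bw] by simp
  moreover have "z \<bullet> (B *\<^sub>v w) = w \<bullet> w - w \<bullet> (B *\<^sub>v w)"
    using symmetric_scalar_prod[OF carrier psd_matD(1)[OF psd carrier] z w]
      minus_scalar_prod_distrib[OF w Bw w] comm_scalar_prod[OF Bw w] by (simp add: Bz')
  ultimately have "w \<bullet> w \<le> v \<bullet> w"
    using zw form_le[OF w] psd_matD(2)[OF psd carrier z] by simp
  also have "\<dots> \<le> v \<bullet> v" using form_le[OF v] by (simp add: w_def)
  finally show ?thesis by (simp add: w_def)
qed

lemma norm_pow_mult_le:
  assumes "v \<in> carrier_vec n"
  shows "(B ^\<^sub>m k *\<^sub>v v) \<bullet> (B ^\<^sub>m k *\<^sub>v v) \<le> v \<bullet> v"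
proof (induction k)
  case 0
  then show ?case using assms carrier by simp
next
  case (Suc k)
  have "B ^\<^sub>m Suc k *\<^sub>v v = B *\<^sub>v (B ^\<^sub>m k *\<^sub>v v)"
    using carrier pow_carrier[of k] assms by (simp only: pow_Suc assoc_mult_mat_vec)
  then show ?case
    using norm_mult_le[of "B ^\<^sub>m k *\<^sub>v v"] Suc pow_carrier[of k] assms by auto
qed

lemma form_pow_le:
  assumes "v \<in> carrier_vec n"
  shows "\<bar>v \<bullet> (B ^\<^sub>m k *\<^sub>v v)\<bar> \<le> v \<bullet> v"
  using abs_scalar_prod_le[OF assms, of "B ^\<^sub>m k *\<^sub>v v"] norm_pow_mult_le[OF assms, of k]
    pow_carrier[of k] assms by auto

text \<open>The bound is uniform in \<open>k\<close>, so the coefficients alone dominate the series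
  of each entry.\<close>

lemma pow_entry_le:
  assumes "i < n" "j < n"
  shows "\<bar>(B ^\<^sub>m k) $$ (i, j)\<bar> \<le> 1"
proof -
  define P where "P = B ^\<^sub>m k"
  have P: "P \<in> carrier_mat n n" by (simp add: P_def pow_carrier)
  have "P $$ (i, j) = unit_vec n i \<bullet> (P *\<^sub>v unit_vec n j)"
    using assms P by simp
  also have "\<bar>\<dots>\<bar> \<le> 1"
    using abs_scalar_prod_le[of "unit_vec n i" n "P *\<^sub>v unit_vec n j"]
      norm_pow_mult_le[of "unit_vec n j" k, folded P_def] assms P by auto
  finally show ?thesis by (simp add: P_def)
qed

lemma pow_symmetric: "(B ^\<^sub>m k)\<^sup>T = B ^\<^sub>m k"
proof (induction k)
  case (Suc k)
  have "(B ^\<^sub>m Suc k)\<^sup>T = (B ^\<^sub>m k * B)\<^sup>T" by simp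
  also have "\<dots> = B\<^sup>T * (B ^\<^sub>m k)\<^sup>T" by (rule transpose_mult[OF pow_carrier carrier])
  finally show ?case
    unfolding pow_Suc using Suc psd_matD(1)[OF psd carrier] by simp
qed (use carrier in simp)

lemma pow_commute:
  assumes V: "V \<in> carrier_mat n n" and comm: "B * V = V * B"
  shows "B ^\<^sub>m k * V = V * B ^\<^sub>m k"
proof (induction k)
  case 0
  then show ?case using V carrier by simp
next
  case (Suc k)
  have "B ^\<^sub>m Suc k * V = B * (B ^\<^sub>m k * V)"
    unfolding pow_Suc by (rule assoc_mult_mat[OF carrier pow_carrier V])
  also have "\<dots> = (B * V) * B ^\<^sub>m k"
    unfolding Suc by (rule assoc_mult_mat[OF carrier V pow_carrier, symmetric])
  also have "\<dots> = V * B ^\<^sub>m Suc k"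
    unfolding comm pow_Suc by (rule assoc_mult_mat[OF V carrier pow_carrier])
  finally show ?case .
qed

text \<open>The square root of \<open>1 - B\<close>, summed entry by entry so that only real series
  occur.\<close>

definition sqrt_series :: "real mat" where
  "sqrt_series = mat n n (\<lambda>(i, j). \<Sum>k. sqrt_coeff k * (B ^\<^sub>m k) $$ (i, j))"

lemma sqrt_series_carrier: "sqrt_series \<in> carrier_mat n n"
  by (simp add: sqrt_series_def)

lemma summable_abs_entries:
  assumes "i < n" "j < n"
  shows "summable (\<lambda>k. \<bar>sqrt_coeff k * (B ^\<^sub>m k) $$ (i, j)\<bar>)"
proof (rule summable_comparison_test'[OF summable_abs_sqrt_coeff, of 0])
  fix k show "norm \<bar>sqrt_coeff k * (B ^\<^sub>m k) $$ (i, j)\<bar> \<le> \<bar>sqrt_coeff k\<bar>"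
    using pow_entry_le[OF assms] by (auto simp: abs_mult intro: mult_left_le)
qed

lemma sqrt_series_sums:
  assumes "i < n" "j < n"
  shows "(\<lambda>k. sqrt_coeff k * (B ^\<^sub>m k) $$ (i, j)) sums (sqrt_series $$ (i, j))"
  using assms summable_rabs_cancel[OF summable_abs_entries[OF assms]]
  by (auto simp: sqrt_series_def summable_sums)

lemma sqrt_series_symmetric: "sqrt_series\<^sup>T = sqrt_series"
proof (rule eq_matI)
  fix i j assume "i < dim_row sqrt_series" "j < dim_col sqrt_series"
  then have ij: "i < n" "j < n" using sqrt_series_carrier by auto
  have "(B ^\<^sub>m k) $$ (i, j) = (B ^\<^sub>m k) $$ (j, i)" for k
    using symmetric_mat_entry[OF pow_carrier pow_symmetric ij] .
  then show "sqrt_series\<^sup>T $$ (i, j) = sqrt_series $$ (i, j)"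
    using ij by (simp add: sqrt_series_def)
qed (use sqrt_series_carrier in auto)

text \<open>Each power of \<open>B\<close> commutes with \<open>V\<close>, and this passes to the
  limit in every entry because a matrix product is a finite sum. It later reduces uniqueness of the
  root to the commuting case.\<close>

lemma sqrt_series_commute:
  assumes V: "V \<in> carrier_mat n n" and comm: "B * V = V * B"
  shows "sqrt_series * V = V * sqrt_series"
proof (rule eq_matI)
  fix i j assume "i < dim_row (V * sqrt_series)" "j < dim_col (V * sqrt_series)"
  then have ij: "i < n" "j < n" using V sqrt_series_carrier by auto
  have "(\<lambda>k. \<Sum>l\<in>{0..<n}. sqrt_coeff k * (B ^\<^sub>m k) $$ (i, l) * V $$ (l, j))
      sums (\<Sum>l\<in>{0..<n}. sqrt_series $$ (i, l) * V $$ (l, j))"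
    using ij by (intro sums_sum sums_mult2 sqrt_series_sums) auto
  moreover have "(\<lambda>k. \<Sum>l\<in>{0..<n}. V $$ (i, l) * (sqrt_coeff k * (B ^\<^sub>m k) $$ (l, j)))
      sums (\<Sum>l\<in>{0..<n}. V $$ (i, l) * sqrt_series $$ (l, j))"
    using ij by (intro sums_sum sums_mult sqrt_series_sums) auto
  moreover have "(\<Sum>l\<in>{0..<n}. sqrt_coeff k * (B ^\<^sub>m k) $$ (i, l) * V $$ (l, j)) =
      (\<Sum>l\<in>{0..<n}. V $$ (i, l) * (sqrt_coeff k * (B ^\<^sub>m k) $$ (l, j)))" for k
  proof -
    have "(B ^\<^sub>m k * V) $$ (i, j) = (V * B ^\<^sub>m k) $$ (i, j)"
      using pow_commute[OF V comm] by simp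
    then have "(\<Sum>l\<in>{0..<n}. (B ^\<^sub>m k) $$ (i, l) * V $$ (l, j)) =
        (\<Sum>l\<in>{0..<n}. V $$ (i, l) * (B ^\<^sub>m k) $$ (l, j))"
      by (simp only: mult_mat_entry[OF pow_carrier V ij] mult_mat_entry[OF V pow_carrier ij])
    then have "sqrt_coeff k * (\<Sum>l\<in>{0..<n}. (B ^\<^sub>m k) $$ (i, l) * V $$ (l, j)) =
        sqrt_coeff k * (\<Sum>l\<in>{0..<n}. V $$ (i, l) * (B ^\<^sub>m k) $$ (l, j))" by simp
    then show ?thesis by (simp add: sum_distrib_left algebra_simps)
  qed
  ultimately have "(\<Sum>l\<in>{0..<n}. sqrt_series $$ (i, l) * V $$ (l, j)) =
      (\<Sum>l\<in>{0..<n}. V $$ (i, l) * sqrt_series $$ (l, j))"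
    by (metis (no_types, lifting) sums_unique2 sums_cong)
  then show "(sqrt_series * V) $$ (i, j) = (V * sqrt_series) $$ (i, j)"
    by (simp only: mult_mat_entry[OF sqrt_series_carrier V ij] mult_mat_entry[OF V sqrt_series_carrier ij])
qed (use V sqrt_series_carrier in auto)

text \<open>The Cauchy product of the absolutely convergent entry series, with the finite sum of the
  matrix product pulled inside, has as \<open>k\<close>-th term the coefficient convolution times
  \<open>B ^ k\<close>. Only \<open>k = 0\<close> and \<open>k = 1\<close> survive, leaving
  \<open>1 - B\<close>.\<close>

lemma sqrt_series_square: "sqrt_series * sqrt_series = 1\<^sub>m n - B"
proof (rule eq_matI)
  fix i j assume "i < dim_row (1\<^sub>m n - B)" "j < dim_col (1\<^sub>m n - B)"
  then have ij: "i < n" "j < n" using carrier by auto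
  let ?a = "\<lambda>i l k. sqrt_coeff k * (B ^\<^sub>m k) $$ (i, l)"
  have "(\<lambda>k. \<Sum>l\<in>{0..<n}. \<Sum>m\<le>k. ?a i l m * ?a l j (k - m))
      sums (\<Sum>l\<in>{0..<n}. (\<Sum>k. ?a i l k) * (\<Sum>k. ?a l j k))"
    using ij by (intro sums_sum Cauchy_product_sums) (auto intro!: summable_abs_entries)
  also have "(\<lambda>k. \<Sum>l\<in>{0..<n}. \<Sum>m\<le>k. ?a i l m * ?a l j (k - m)) =
      (\<lambda>k. (if k = 0 then 1 else if k = 1 then - 1 else 0) * (B ^\<^sub>m k) $$ (i, j))"
  proof
    fix k
    have pow: "(\<Sum>l\<in>{0..<n}. (B ^\<^sub>m m) $$ (i, l) * (B ^\<^sub>m (k - m)) $$ (l, j)) = (B ^\<^sub>m k) $$ (i, j)"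
      if "m \<le> k" for m
    proof -
      have "(B ^\<^sub>m k) $$ (i, j) = (B ^\<^sub>m m * B ^\<^sub>m (k - m)) $$ (i, j)"
        using pow_add[of m "k - m"] that by simp
      then show ?thesis
        by (simp only: mult_mat_entry[OF pow_carrier pow_carrier ij])
    qed
    have "(\<Sum>l\<in>{0..<n}. \<Sum>m\<le>k. ?a i l m * ?a l j (k - m)) =
        (\<Sum>m\<le>k. sqrt_coeff m * sqrt_coeff (k - m) *
          (\<Sum>l\<in>{0..<n}. (B ^\<^sub>m m) $$ (i, l) * (B ^\<^sub>m (k - m)) $$ (l, j)))"
      by (subst sum.swap) (simp add: sum_distrib_left algebra_simps)
    also have "\<dots> = (\<Sum>m\<le>k. sqrt_coeff m * sqrt_coeff (k - m) * (B ^\<^sub>m k) $$ (i, j))"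
      by (intro sum.cong refl) (simp add: pow)
    also have "\<dots> = (\<Sum>m\<le>k. sqrt_coeff m * sqrt_coeff (k - m)) * (B ^\<^sub>m k) $$ (i, j)"
      by (simp add: sum_distrib_right)
    finally show "(\<Sum>l\<in>{0..<n}. \<Sum>m\<le>k. ?a i l m * ?a l j (k - m)) =
        (if k = 0 then 1 else if k = 1 then - 1 else 0) * (B ^\<^sub>m k) $$ (i, j)"
      by (simp only: sqrt_coeff_convolution)
  qed
  finally have "(\<lambda>k. (if k = 0 then 1 else if k = 1 then - 1 else 0) * (B ^\<^sub>m k) $$ (i, j))
      sums (\<Sum>l\<in>{0..<n}. (\<Sum>k. ?a i l k) * (\<Sum>k. ?a l j k))" .
  moreover have "(\<lambda>k. (if k = 0 then 1 else if k = 1 then - 1 else 0) * (B ^\<^sub>m k) $$ (i, j))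
      sums (\<Sum>k\<in>{0, 1}. (if k = 0 then 1 else if k = 1 then - 1 else 0) * (B ^\<^sub>m k) $$ (i, j))"
    by (rule sums_finite) auto
  ultimately have "(\<Sum>l\<in>{0..<n}. (\<Sum>k. ?a i l k) * (\<Sum>k. ?a l j k)) =
      (\<Sum>k\<in>{0, 1}. (if k = 0 then 1 else if k = 1 then - 1 else 0) * (B ^\<^sub>m k) $$ (i, j))"
    by (rule sums_unique2)
  moreover have "(sqrt_series * sqrt_series) $$ (i, j) =
      (\<Sum>l\<in>{0..<n}. (\<Sum>k. ?a i l k) * (\<Sum>k. ?a l j k))"
    using ij by (simp add: sqrt_series_def scalar_prod_def)
  ultimately show "(sqrt_series * sqrt_series) $$ (i, j) = (1\<^sub>m n - B) $$ (i, j)"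
    using ij carrier by simp
qed (use carrier sqrt_series_carrier in auto)

text \<open>The term \<open>k = 0\<close> contributes \<open>v . v\<close>. Each later form is at
  most \<open>v . v\<close> in absolute value and the later coefficients have absolute sum at most
  1, so they cannot outweigh it.\<close>

lemma sqrt_series_psd: "psd_mat sqrt_series"
proof (rule psd_matI[OF sqrt_series_carrier sqrt_series_symmetric])
  fix v :: "real vec" assume v: "v \<in> carrier_vec n"
  have form: "v \<bullet> (M *\<^sub>v v) = (\<Sum>i\<in>{0..<n}. v $ i * (\<Sum>j\<in>{0..<n}. M $$ (i, j) * v $ j))"
    if "M \<in> carrier_mat n n" for M
    using that v by (simp add: scalar_prod_def)
  have "(\<lambda>k. \<Sum>i\<in>{0..<n}. v $ i * (\<Sum>j\<in>{0..<n}. sqrt_coeff k * (B ^\<^sub>m k) $$ (i, j) * v $ j))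
      sums (v \<bullet> (sqrt_series *\<^sub>v v))"
    unfolding form[OF sqrt_series_carrier]
    by (intro sums_sum sums_mult sums_mult2 sqrt_series_sums) auto
  also have "(\<lambda>k. \<Sum>i\<in>{0..<n}. v $ i * (\<Sum>j\<in>{0..<n}. sqrt_coeff k * (B ^\<^sub>m k) $$ (i, j) * v $ j)) =
      (\<lambda>k. sqrt_coeff k * (v \<bullet> (B ^\<^sub>m k *\<^sub>v v)))"
    by (simp add: form[OF pow_carrier] sum_distrib_left algebra_simps)
  finally have sums: "(\<lambda>k. sqrt_coeff k * (v \<bullet> (B ^\<^sub>m k *\<^sub>v v))) sums (v \<bullet> (sqrt_series *\<^sub>v v))" .
  then have sums': "(\<lambda>k. sqrt_coeff (Suc k) * (v \<bullet> (B ^\<^sub>m Suc k *\<^sub>v v)))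
      sums (v \<bullet> (sqrt_series *\<^sub>v v) - v \<bullet> v)"
    using carrier v by (subst sums_Suc_iff) (simp add: sqrt_coeff_0)
  have "(\<Sum>k. \<bar>sqrt_coeff (Suc k)\<bar>) \<le> 1"
    using suminf_le_const[OF summable_abs_sqrt_coeff_Suc sqrt_coeff_Suc_sum_le] .
  then have "- (v \<bullet> v) \<le> - ((\<Sum>k. \<bar>sqrt_coeff (Suc k)\<bar>) * (v \<bullet> v))"
    using scalar_prod_real_self_nonneg[of v] by (simp add: mult_left_le_one_le suminf_nonneg[OF summable_abs_sqrt_coeff_Suc])
  also have "\<dots> \<le> v \<bullet> (sqrt_series *\<^sub>v v) - v \<bullet> v"
  proof (rule sums_le[OF _ _ sums'])
    show "(\<lambda>k. - (\<bar>sqrt_coeff (Suc k)\<bar> * (v \<bullet> v))) sums - ((\<Sum>k. \<bar>sqrt_coeff (Suc k)\<bar>) * (v \<bullet> v))"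
      by (intro sums_minus sums_mult2 summable_sums summable_abs_sqrt_coeff_Suc)
    fix k
    have "\<bar>sqrt_coeff (Suc k) * (v \<bullet> (B ^\<^sub>m Suc k *\<^sub>v v))\<bar> \<le> \<bar>sqrt_coeff (Suc k)\<bar> * (v \<bullet> v)"
      unfolding abs_mult by (intro mult_left_mono form_pow_le v) auto
    then show "- (\<bar>sqrt_coeff (Suc k)\<bar> * (v \<bullet> v)) \<le> sqrt_coeff (Suc k) * (v \<bullet> (B ^\<^sub>m Suc k *\<^sub>v v))"
      by linarith
  qed
  finally show "0 \<le> v \<bullet> (sqrt_series *\<^sub>v v)" by simp
qed

end

section \<open>Existence and uniqueness for arbitrary positive semidefinite matrices\<close>

lemma psd_sqrt_exists_commuting:
  assumes A: "A \<in> carrier_mat n n" and psd: "psd_mat A"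
  obtains U where "U \<in> carrier_mat n n" "psd_mat U" "U * U = A"
    "\<And>V. V \<in> carrier_mat n n \<Longrightarrow> A * V = V * A \<Longrightarrow> U * V = V * U"
proof -
  \<comment> \<open>An upper bound for the form of \<open>A\<close> on unit vectors; the summand 1
    makes it positive even for the zero matrix.\<close>
  define s where "s = 1 + (\<Sum>i\<in>{0..<n}. \<Sum>j\<in>{0..<n}. \<bar>A $$ (i, j)\<bar>)"
  have s: "s > 0" unfolding s_def by (intro add_pos_nonneg sum_nonneg) auto
  have le: "v \<bullet> (A *\<^sub>v v) \<le> s * (v \<bullet> v)" if v: "v \<in> carrier_vec n" for v
  proof -
    have sq: "v $ i * v $ i \<le> v \<bullet> v" if "i < n" for i
      using that v member_le_sum[of i "{0..<n}" "\<lambda>i. v $ i * v $ i"] by (simp add: scalar_prod_def)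
    have "v $ i * (A $$ (i, j) * v $ j) \<le> \<bar>A $$ (i, j)\<bar> * (v \<bullet> v)" if "i < n" "j < n" for i j
    proof -
      have "2 * \<bar>v $ i * v $ j\<bar> \<le> v $ i * v $ i + v $ j * v $ j"
        using sum_squares_bound[of "\<bar>v $ i\<bar>" "\<bar>v $ j\<bar>"] by (simp add: abs_mult power2_eq_square)
      then have "\<bar>v $ i * v $ j\<bar> \<le> v \<bullet> v" using sq[OF that(1)] sq[OF that(2)] by linarith
      then have "\<bar>A $$ (i, j)\<bar> * \<bar>v $ i * v $ j\<bar> \<le> \<bar>A $$ (i, j)\<bar> * (v \<bullet> v)"
        by (intro mult_left_mono) auto
      moreover have "v $ i * (A $$ (i, j) * v $ j) \<le> \<bar>A $$ (i, j)\<bar> * \<bar>v $ i * v $ j\<bar>"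
        using abs_ge_self[of "v $ i * (A $$ (i, j) * v $ j)"] by (simp add: abs_mult ac_simps)
      ultimately show ?thesis by linarith
    qed
    then have "v \<bullet> (A *\<^sub>v v) \<le> (\<Sum>i\<in>{0..<n}. \<Sum>j\<in>{0..<n}. \<bar>A $$ (i, j)\<bar> * (v \<bullet> v))"
      using A v by (auto simp: scalar_prod_def sum_distrib_left intro!: sum_mono)
    also have "\<dots> \<le> s * (v \<bullet> v)"
      using scalar_prod_real_self_nonneg[of v] by (simp add: s_def sum_distrib_right distrib_right)
    finally show ?thesis .
  qed
  \<comment> \<open>Since \<open>0 <= A <= s\<close>, this satisfies \<open>0 <= B <= 1\<close>, and
    \<open>A = s (1 - B)\<close> has the root \<open>sqrt s\<close> times
    \<open>sqrt_series\<close>.\<close>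
  define B where "B = 1\<^sub>m n - (1 / s) \<cdot>\<^sub>m A"
  have B: "B \<in> carrier_mat n n"
    unfolding B_def by (intro minus_carrier_mat smult_carrier_mat A)
  have Bv: "v \<bullet> (B *\<^sub>v v) = v \<bullet> v - (v \<bullet> (A *\<^sub>v v)) / s" if v: "v \<in> carrier_vec n" for v
  proof -
    have "B *\<^sub>v v = v - (1 / s) \<cdot>\<^sub>v (A *\<^sub>v v)"
      using A v by (auto simp: B_def minus_mult_distrib_mat_vec[of _ n n] smult_mat_mult_vec[of _ n])
    then show ?thesis using A v by (simp add: scalar_prod_minus_distrib[of _ n])
  qed
  have BT: "B\<^sup>T = B"
  proof (rule eq_matI)
    fix i j assume "i < dim_row B" "j < dim_col B"
    then have ij: "i < n" "j < n" using B by auto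
    have "A $$ (j, i) = A $$ (i, j)"
      using symmetric_mat_entry[OF A psd_matD(1)[OF psd A] ij(2,1)] .
    then show "B\<^sup>T $$ (i, j) = B $$ (i, j)" using ij A by (simp add: B_def)
  qed (use B in auto)
  interpret psd_contraction n B
  proof
    show "psd_mat B" using B BT
    proof (rule psd_matI)
      fix v :: "real vec" assume "v \<in> carrier_vec n"
      then show "0 \<le> v \<bullet> (B *\<^sub>v v)" using le[of v] s by (simp add: Bv field_simps)
    qed
    fix v :: "real vec" assume "v \<in> carrier_vec n"
    then show "v \<bullet> (B *\<^sub>v v) \<le> v \<bullet> v" using psd_matD(2)[OF psd A] s by (simp add: Bv)
  qed (rule B)
  define U where "U = sqrt s \<cdot>\<^sub>m sqrt_series"
  show thesis
  proof (rule that)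
    show U: "U \<in> carrier_mat n n" using sqrt_series_carrier by (simp add: U_def)
    show "psd_mat U"
    proof (rule psd_matI[OF U])
      have "U\<^sup>T = sqrt s \<cdot>\<^sub>m sqrt_series\<^sup>T" by (rule eq_matI) (auto simp: U_def)
      then show "U\<^sup>T = U" by (simp add: sqrt_series_symmetric U_def)
      fix v :: "real vec" assume v: "v \<in> carrier_vec n"
      have "U *\<^sub>v v = sqrt s \<cdot>\<^sub>v (sqrt_series *\<^sub>v v)"
        using v sqrt_series_carrier by (simp add: U_def smult_mat_mult_vec[of _ n])
      then show "0 \<le> v \<bullet> (U *\<^sub>v v)"
        using psd_matD(2)[OF sqrt_series_psd sqrt_series_carrier v] s v sqrt_series_carrier by simp
    qed
    have "U * U = (sqrt s * sqrt s) \<cdot>\<^sub>m (sqrt_series * sqrt_series)"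
      using sqrt_series_carrier
      by (auto simp: U_def mult_smult_assoc_mat[of _ n n _ n] mult_smult_distrib[of _ n n _ n])
    also have "\<dots> = A"
      unfolding sqrt_series_square using A s by (auto simp: B_def)
    finally show "U * U = A" .
    fix V assume V: "V \<in> carrier_mat n n" and comm: "A * V = V * A"
    have "B * V = V * B"
      using A V comm by (simp add: B_def minus_mult_distrib_mat[of _ n n _ _ n] mult_minus_distrib_mat[of _ n n _ n]
          mult_smult_assoc_mat[of _ n n _ n] mult_smult_distrib[of _ n n _ n])
    then show "U * V = V * U"
      using sqrt_series_commute[OF V] V sqrt_series_carrier
      by (simp add: U_def mult_smult_assoc_mat[of _ n n _ n] mult_smult_distrib[of _ n n _ n])
  qed
qed

text \<open>Any positive semidefinite root \<open>V\<close> commutes with \<open>A = V * V\<close>,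
  hence with the constructed root \<open>U\<close>, so the commuting case of uniqueness applies.
  This makes the \<open>THE\<close> in \<open>psd_sqrt\<close> denote \<open>U\<close>.\<close>

lemma psd_sqrt_works:
  assumes A: "A \<in> carrier_mat n n" and psd: "psd_mat A"
  shows "psd_sqrt A \<in> carrier_mat n n" "psd_mat (psd_sqrt A)" "psd_sqrt A * psd_sqrt A = A"
proof -
  obtain U where U: "U \<in> carrier_mat n n" "psd_mat U" "U * U = A"
    and comm: "\<And>V. V \<in> carrier_mat n n \<Longrightarrow> A * V = V * A \<Longrightarrow> U * V = V * U"
    using psd_sqrt_exists_commuting[OF assms] by blast
  have "V = U" if V: "psd_mat V" "V * V = A" for V
  proof -
    \<comment> \<open>\<open>psd_mat\<close> fixes no dimension, so the size of \<open>V\<close> is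
      read off from \<open>V * V = A\<close>.\<close>
    have "dim_row V = dim_row (V * V)" by simp
    then have Vc: "V \<in> carrier_mat n n" using V A by (auto simp: psd_mat_def)
    have "A * V = V * A" using assoc_mult_mat[OF Vc Vc Vc] V(2) by simp
    have "U = V"
    proof (rule psd_mat_square_inj_commuting[OF U(1,2) Vc V(1)])
      show "U * V = V * U" by (rule comm) fact+
      show "U * U = V * V" using U(3) V(2) by simp
    qed
    then show ?thesis by simp
  qed
  then have "psd_sqrt A = U" unfolding psd_sqrt_def using U(2,3) by (intro the_equality) blast+
  then show "psd_sqrt A \<in> carrier_mat n n" "psd_mat (psd_sqrt A)" "psd_sqrt A * psd_sqrt A = A"
    using U by auto
qed

text \<open>Symmetry of the root turns the rows in the product into columns, which exhibits
  \<open>A\<close> as a Gram matrix.\<close>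

lemma psd_sqrt_entry:
  assumes A: "A \<in> carrier_mat n n" and psd: "psd_mat A" and ij: "i < n" "j < n"
  shows "A $$ (i, j) = col (psd_sqrt A) i \<bullet> col (psd_sqrt A) j"
proof -
  let ?U = "psd_sqrt A"
  note U = psd_sqrt_works[OF A psd]
  have "row ?U i = row (?U\<^sup>T) i" using psd_matD(1)[OF U(2,1)] by simp
  also have "\<dots> = col ?U i" using U(1) ij by (simp add: row_transpose)
  finally show ?thesis
    using U(1) ij arg_cong[OF U(3), of "\<lambda>M. M $$ (i, j)"] by simp
qed

lemma psd_sqrt_col_norm:
  assumes "A \<in> carrier_mat n n" "psd_mat A" "k < n"
  shows "(l2_norm_vec (col (psd_sqrt A) k))\<^sup>2 = A $$ (k, k)"
  using psd_sqrt_entry[OF assms assms(3)]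
  by (simp add: l2_norm_vec_def scalar_prod_real_self_nonneg)

subsection \<open>Gaussian second moments\<close>

definition std_normal :: "real measure" where
  "std_normal = density lborel (\<lambda>x. ennreal (std_normal_density x))"

lemma prob_space_std_normal: "prob_space std_normal"
  unfolding std_normal_def by (rule prob_space_normal_density) simp

lemma sets_std_normal [measurable_cong, simp]: "sets std_normal = sets borel"
  by (simp add: std_normal_def)

lemma std_gaussian_eq: "std_gaussian n = (\<Pi>\<^sub>M i\<in>{..<n}. std_normal)"
  by (simp add: std_gaussian_def std_normal_def)

lemma std_normal_moments:
  shows "has_bochner_integral std_normal (\<lambda>x. x) 0"
    and "has_bochner_integral std_normal (\<lambda>x. x * x) 1"
    and "has_bochner_integral std_normal (\<lambda>x. 1) (1::real)"
proof -
  have *: "has_bochner_integral std_normal f c"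
    if "has_bochner_integral lborel (\<lambda>x. std_normal_density x * f x) c" and "f \<in> borel_measurable borel"
    for f :: "real \<Rightarrow> real" and c
    unfolding std_normal_def using that by (intro has_bochner_integral_density) auto
  show "has_bochner_integral std_normal (\<lambda>x. x) 0"
    using std_normal_moment_odd[of 0] by (intro *) auto
  show "has_bochner_integral std_normal (\<lambda>x. x * x) 1"
    using std_normal_moment_even[of 1] by (intro *) (auto simp: power2_eq_square)
  show "has_bochner_integral std_normal (\<lambda>x. 1) (1::real)"
    using std_normal_moment_even[of 0] by (intro *) auto
qed

lemma prob_space_std_gaussian: "prob_space (std_gaussian n)"
  unfolding std_gaussian_eq by (intro prob_space_PiM prob_space_std_normal)

text \<open>The monomial is a product of one factor per coordinate, so its integral over the product
  measure factorizes; for distinct indices a factor with mean 0 appears.\<close>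

lemma std_gaussian_covariance:
  assumes "i < n" "j < n"
  shows "has_bochner_integral (std_gaussian n) (\<lambda>g. g i * g j) (if i = j then 1 else 0)"
proof -
  interpret product_sigma_finite "\<lambda>_::nat. std_normal"
    by (simp add: product_sigma_finite_def prob_space_imp_sigma_finite prob_space_std_normal)
  \<comment> \<open>The two conditionals multiply to \<open>x * x\<close> at
    \<open>k = i = j\<close>, to \<open>x\<close> at \<open>i\<close> and at \<open>j\<close> when
    these differ, and to 1 elsewhere.\<close>
  define f :: "nat \<Rightarrow> real \<Rightarrow> real" where
    "f k x = (if k = i then x else 1) * (if k = j then x else 1)" for k x
  have f: "has_bochner_integral std_normal (f k)
      ((if k = i then 1 else if k = j then 0 else 1) * (if i = j then 1 else if k = i then 0 else 1))" for k
    using std_normal_moments by (auto simp: f_def[abs_def])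
  have eq: "(\<Prod>k<n. f k (g k)) = g i * g j" for g
    using assms by (simp add: f_def prod.distrib prod.delta)
  have "integrable (std_gaussian n) (\<lambda>g. \<Prod>k<n. f k (g k))"
    unfolding std_gaussian_eq using f by (intro product_integrable_prod) (auto simp: has_bochner_integral_iff)
  moreover have "(\<integral>g. (\<Prod>k<n. f k (g k)) \<partial>std_gaussian n) = (\<Prod>k<n. integral\<^sup>L std_normal (f k))"
    unfolding std_gaussian_eq using f by (intro product_integral_prod) (auto simp: has_bochner_integral_iff)
  moreover have "(\<Prod>k<n. integral\<^sup>L std_normal (f k)) = (if i = j then 1 else 0)"
  proof (cases "i = j")
    case True
    then show ?thesis using has_bochner_integral_integral_eq[OF f] by (auto intro!: prod.neutral)
  next
    case False
    then show ?thesis using has_bochner_integral_integral_eq[OF f] assms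
      by (auto intro!: prod_zero bexI[of _ i])
  qed
  ultimately show ?thesis by (simp add: eq has_bochner_integral_iff)
qed

lemma scalar_prod_vec: "u \<bullet> vec n g = (\<Sum>i<n. u $ i * (g i :: real))"
  by (simp add: scalar_prod_def atLeast0LessThan)

lemma measurable_std_gaussian_scalar_prod [measurable]:
  "(\<lambda>g. u \<bullet> vec n g) \<in> borel_measurable (std_gaussian n)"
  unfolding scalar_prod_vec std_gaussian_eq by measurable

text \<open>After expanding the square only the diagonal of the covariance survives.\<close>

lemma std_gaussian_second_moment:
  assumes "u \<in> carrier_vec n"
  shows "has_bochner_integral (std_gaussian n) (\<lambda>g. (u \<bullet> vec n g)\<^sup>2) (u \<bullet> u)"
proof -
  have "has_bochner_integral (std_gaussian n)
      (\<lambda>g. \<Sum>i<n. \<Sum>j<n. u $ i * u $ j * (g i * g j)) (\<Sum>i<n. \<Sum>j<n. u $ i * u $ j * (if i = j then 1 else 0))"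
    by (intro has_bochner_integral_sum has_bochner_integral_mult_right std_gaussian_covariance) auto
  also have "(\<lambda>g. \<Sum>i<n. \<Sum>j<n. u $ i * u $ j * (g i * g j)) = (\<lambda>g. (u \<bullet> vec n g)\<^sup>2)"
    by (simp add: scalar_prod_vec power2_eq_square sum_product algebra_simps)
  also have "(\<Sum>i<n. \<Sum>j<n. u $ i * u $ j * (if i = j then 1 else 0)) = u \<bullet> u"
    using assms by (simp add: scalar_prod_def atLeast0LessThan if_distrib[of "(*) _"] sum.delta cong: if_cong)
  finally show ?thesis .
qed

subsection \<open>The rounding step for a fixed Gaussian vector\<close>

lemma clip_bounds: "\<bar>clip x\<bar> \<le> 1" "\<bar>clip x\<bar> \<le> \<bar>x\<bar>"
  by (auto simp: clip_def)

lemma clip_0 [simp]: "clip 0 = 0"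
  by (simp add: clip_def)

lemma measurable_clip [measurable]: "clip \<in> borel_measurable borel"
  unfolding clip_def by measurable

text \<open>The explicit case formula is what makes measurability in \<open>y\<close>
  visible.\<close>

lemma pmf_sample_entry:
  assumes "\<bar>y\<bar> \<le> 1"
  shows "pmf (sample_entry y) v =
    (if y > 0 \<and> v = 1 then y else if y < 0 \<and> v = -1 then - y else if v = 0 then 1 - \<bar>y\<bar> else 0)"
proof -
  have "pmf (sample_entry y) v = measure (bernoulli_pmf \<bar>y\<bar>) {b. (if b then sgn y else 0) = v}"
    by (simp add: sample_entry_def pmf_map vimage_def)
  also have "\<dots> = (\<integral>b. indicator {b. (if b then sgn y else 0) = v} b \<partial>bernoulli_pmf \<bar>y\<bar>)"
    by simp
  also have "\<dots> = indicator {b. (if b then sgn y else 0) = v} True * \<bar>y\<bar> +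
      indicator {b. (if b then sgn y else 0) = v} False * (1 - \<bar>y\<bar>)"
    using assms by (subst integral_bernoulli_pmf) auto
  also have "\<dots> = (if y > 0 \<and> v = 1 then y else if y < 0 \<and> v = -1 then - y
      else if v = 0 then 1 - \<bar>y\<bar> else 0)"
    by (auto simp: sgn_if split: split_indicator)
  finally show ?thesis .
qed

lemma pmf_sample_sign:
  assumes "\<bar>y\<bar> \<le> 1"
  shows "pmf (sample_sign y) v = (if v = 1 then (1 + y) / 2 else if v = -1 then (1 - y) / 2 else 0)"
proof -
  have "pmf (sample_sign y) v = (\<integral>b. indicator {b. (if b then 1 else -1) = v} b \<partial>bernoulli_pmf ((1 + y) / 2))"
    by (simp add: sample_sign_def pmf_map vimage_def)
  also have "\<dots> = indicator {b. (if b then 1 else -1) = v} True * ((1 + y) / 2) +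
      indicator {b. (if b then 1 else -1) = v} False * (1 - (1 + y) / 2)"
    using assms by (subst integral_bernoulli_pmf) (auto simp: abs_le_iff)
  also have "\<dots> = (if v = 1 then (1 + y) / 2 else if v = -1 then (1 - y) / 2 else 0)"
    by (auto split: split_indicator simp: field_simps)
  finally show ?thesis .
qed

lemma set_sample_entry: "set_pmf (sample_entry y) \<subseteq> {-1, 0, 1}"
  by (auto simp: sample_entry_def sgn_if)

lemma set_sample_sign: "set_pmf (sample_sign y) \<subseteq> {-1, 1}"
  by (auto simp: sample_sign_def)

text \<open>The law of \<open>x\<^sub>k\<close> given \<open>g\<close>, where \<open>z = u\<^sub>k\<^sup>T g\<close>: integrating out \<open>\<epsilon>\<^sub>k\<close> keeps the entries independent.\<close>

definition sparse_entry :: "real \<Rightarrow> real \<Rightarrow> real \<Rightarrow> real pmf" where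
  "sparse_entry p T z =
     map_pmf of_bool (bernoulli_pmf p) \<bind> (\<lambda>e. sample_entry (clip (e / p * z / T)))"

lemma set_sparse_entry: "set_pmf (sparse_entry p T z) \<subseteq> {-1, 0, 1}"
  using set_sample_entry by (fastforce simp: sparse_entry_def)

lemma pmf_sparse_entry:
  assumes "0 \<le> p" "p \<le> 1"
  shows "pmf (sparse_entry p T z) v =
    p * pmf (sample_entry (clip (z / p / T))) v + (1 - p) * pmf (sample_entry 0) v"
  using assms by (simp add: sparse_entry_def pmf_bind algebra_simps)

lemma measurable_pmf_sparse_entry [measurable]:
  assumes "0 \<le> p" "p \<le> 1"
  shows "(\<lambda>z. pmf (sparse_entry p T z) v) \<in> borel_measurable borel"
  unfolding pmf_sparse_entry[OF assms] pmf_sample_entry[OF clip_bounds(1)] by measurable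

text \<open>The probability is \<open>p\<close> times the absolute value of a clipped number.
  Bounding the clip by 1 gives the estimate used for feasibility, uniform in \<open>z\<close>;
  bounding it by its argument cancels \<open>p\<close> and gives the estimate used for the
  objective. At \<open>T = 0\<close> the convention \<open>x / 0 = 0\<close> makes both sides of the
  latter vanish.\<close>

lemma prob_sparse_entry_nonzero:
  fixes p T z :: real
  assumes "0 \<le> p" "p \<le> 1" "0 \<le> T"
  defines "q \<equiv> measure (sparse_entry p T z) {x. x \<noteq> 0}"
  shows "q \<le> p" "q \<le> (if p = 0 then 0 else \<bar>z\<bar> / T)"
proof -
  have "q = 1 - pmf (sparse_entry p T z) 0"
    using measure_pmf.prob_compl[of "{0}" "sparse_entry p T z"]
    by (simp add: q_def Compl_eq_Diff_UNIV[symmetric] measure_pmf_single)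
      (metis Collect_neg_eq singleton_conv)
  also have "\<dots> = p * \<bar>clip (z / p / T)\<bar>"
    by (simp add: pmf_sparse_entry assms pmf_sample_entry clip_bounds algebra_simps)
  finally have q: "q = p * \<bar>clip (z / p / T)\<bar>" .
  show "q \<le> p" using clip_bounds(1)[of "z / p / T"] assms(1) by (simp add: q mult_left_le)
  have "q \<le> p * \<bar>z / p / T\<bar>"
    unfolding q using clip_bounds(2) assms(1) by (intro mult_left_mono)
  then show "q \<le> (if p = 0 then 0 else \<bar>z\<bar> / T)"
    using assms(1-3) q by (auto simp: abs_divide abs_mult)
qed

lemma keep_prob_nonneg: "0 \<le> keep_prob C u"
  by (simp add: keep_prob_def)

text \<open>The law of \<open>x0\<close> does not involve the thinning variables, so the two draws
  can be exchanged. Two successive coordinatewise product draws are then one product of composed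
  draws, and the thinning variables are absorbed into the entries.\<close>

lemma round_pmf_eq:
  assumes U: "U \<in> carrier_mat (1 + d) (1 + d)" and g: "g \<in> carrier_vec (1 + d)"
  shows "round_pmf d U C T g = do {
      x0 \<leftarrow> sample_sign (clip (col U 0 \<bullet> g / T));
      x \<leftarrow> Pi_pmf {1..d} 0 (\<lambda>k. sparse_entry (keep_prob C (col U k)) T (col U k \<bullet> g));
      return_pmf (sgn x0 \<cdot>\<^sub>v vec d (\<lambda>i. x (Suc i)))}"
proof -
  have entry: "Pi_pmf {1..d} 0 (\<lambda>k. sample_entry (clip (((\<epsilon> k / keep_prob C (col U k)) \<cdot>\<^sub>v col U k) \<bullet> g / T))) =
    Pi_pmf {1..d} 0 (\<lambda>k. sample_entry (clip (\<epsilon> k / keep_prob C (col U k) * (col U k \<bullet> g) / T)))" for \<epsilon>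
    using U g by (intro Pi_pmf_cong) (auto simp: smult_scalar_prod_distrib[of _ "Suc d"])
  have "round_pmf d U C T g = do {
      x0 \<leftarrow> sample_sign (clip (col U 0 \<bullet> g / T));
      \<epsilon> \<leftarrow> Pi_pmf {1..d} 0 (\<lambda>k. map_pmf of_bool (bernoulli_pmf (keep_prob C (col U k))));
      x \<leftarrow> Pi_pmf {1..d} 0 (\<lambda>k. sample_entry (clip (\<epsilon> k / keep_prob C (col U k) * (col U k \<bullet> g) / T)));
      return_pmf (sgn x0 \<cdot>\<^sub>v vec d (\<lambda>i. x (Suc i)))}"
    unfolding round_pmf_def Let_def entry by (subst bind_commute_pmf) simp
  also have "\<dots> = do {
      x0 \<leftarrow> sample_sign (clip (col U 0 \<bullet> g / T));
      x \<leftarrow> Pi_pmf {1..d} 0 (\<lambda>k. sparse_entry (keep_prob C (col U k)) T (col U k \<bullet> g));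
      return_pmf (sgn x0 \<cdot>\<^sub>v vec d (\<lambda>i. x (Suc i)))}"
    unfolding sparse_entry_def
    by (subst Pi_pmf_bind[where d' = 0]) (simp_all add: bind_assoc_pmf)
  finally show ?thesis .
qed

section \<open>Moments of the number of nonzero coordinates under a product law\<close>

lemma expectation_Pi_pmf_prod_finite:
  fixes f :: "'a \<Rightarrow> real \<Rightarrow> real"
  assumes "finite A" "\<And>k. finite (set_pmf (p k))" "\<And>k x. 0 \<le> f k x"
  shows "measure_pmf.expectation (Pi_pmf A 0 p) (\<lambda>x. \<Prod>k\<in>A. f k (x k)) =
    (\<Prod>k\<in>A. measure_pmf.expectation (p k) (f k))"
  using assms by (intro expectation_prod_Pi_pmf integrable_measure_pmf_finite) auto

lemma expectation_of_bool_eq: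
  "measure_pmf.expectation p (\<lambda>x. of_bool (P x)) = measure (measure_pmf p) {x. P x}"
proof -
  have "(\<lambda>x. of_bool (P x) :: real) = indicator {x. P x}" by (auto split: split_indicator)
  then show ?thesis by simp
qed

lemma finite_set_Pi_pmf:
  assumes "finite A" "\<And>k. finite (set_pmf (p k))"
  shows "finite (set_pmf (Pi_pmf A 0 p))"
  using assms by (simp add: set_Pi_pmf finite_PiE_dflt)

context
  fixes A :: "'a set" and p :: "'a \<Rightarrow> real pmf" and q :: "'a \<Rightarrow> real" and N :: "('a \<Rightarrow> real) \<Rightarrow> nat"
  assumes fin: "finite A" "\<And>k. finite (set_pmf (p k))"
  defines "q \<equiv> \<lambda>k. measure (p k) {x. x \<noteq> 0}"
    and "N \<equiv> \<lambda>x. card {k \<in> A. x k \<noteq> 0}"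
begin

lemma card_nonzero_eq_sum: "real (N x) = (\<Sum>k\<in>A. of_bool (x k \<noteq> 0))"
  using fin(1) by (simp add: N_def of_bool_def sum.If_cases Int_def conj_commute)

lemma integrable_Pi_pmf_finite: "integrable (measure_pmf (Pi_pmf A 0 p)) (f :: _ \<Rightarrow> real)"
  by (intro integrable_measure_pmf_finite finite_set_Pi_pmf fin)

text \<open>The pair of indicators is a product over \<open>A\<close> of factors that are 1 off
  \<open>{k, l}\<close>. For \<open>k = l\<close> the set is a singleton and idempotence of the
  indicator leaves a single factor.\<close>

lemma expectation_nonzero_pair:
  assumes "k \<in> A" "l \<in> A"
  shows "measure_pmf.expectation (Pi_pmf A 0 p) (\<lambda>x. of_bool (x k \<noteq> 0) * of_bool (x l \<noteq> 0)) =
    (if k = l then q k else q k * q l)"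
proof -
  define f :: "'a \<Rightarrow> real \<Rightarrow> real" where
    "f i v = (if i \<in> {k, l} then of_bool (v \<noteq> 0) else 1)" for i v
  have sub: "{k, l} \<subseteq> A" using assms by auto
  have "(\<Prod>i\<in>A. f i (x i)) = (\<Prod>i\<in>{k, l}. f i (x i))" for x
    by (rule prod.mono_neutral_right[OF fin(1) sub]) (auto simp: f_def)
  then have "(\<Prod>i\<in>A. f i (x i)) = of_bool (x k \<noteq> 0) * of_bool (x l \<noteq> 0)" for x
    by (cases "k = l") (auto simp: f_def)
  moreover have "(\<Prod>i\<in>A. measure_pmf.expectation (p i) (f i)) = (\<Prod>i\<in>{k, l}. measure_pmf.expectation (p i) (f i))"
  proof (rule prod.mono_neutral_right[OF fin(1) sub], rule ballI)
    fix i assume "i \<in> A - {k, l}"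
    then have "f i = (\<lambda>_. 1)" by (auto simp: f_def)
    then show "measure_pmf.expectation (p i) (f i) = 1" by simp
  qed
  moreover have "f k = (\<lambda>v. of_bool (v \<noteq> 0))" "f l = (\<lambda>v. of_bool (v \<noteq> 0))"
    by (auto simp: f_def)
  then have "(\<Prod>i\<in>{k, l}. measure_pmf.expectation (p i) (f i)) = (if k = l then q k else q k * q l)"
    by (auto simp: q_def expectation_of_bool_eq)
  ultimately show ?thesis
    using expectation_Pi_pmf_prod_finite[OF fin, of f] by (simp add: f_def)
qed

lemma expectation_card_nonzero: "measure_pmf.expectation (Pi_pmf A 0 p) (\<lambda>x. real (N x)) = (\<Sum>k\<in>A. q k)"
proof -
  have "measure_pmf.expectation (Pi_pmf A 0 p) (\<lambda>x. of_bool (x k \<noteq> 0)) = q k" if "k \<in> A" for k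
    using expectation_nonzero_pair[OF that that] by (simp flip: of_bool_conj)
  then show ?thesis unfolding card_nonzero_eq_sum by (simp add: integrable_Pi_pmf_finite)
qed

text \<open>In the double sum, independence gives \<open>q k * q l\<close> off the diagonal;
  replacing the square by \<open>q k\<close> on the diagonal costs at most one extra sum.\<close>

lemma expectation_card_nonzero_square:
  "measure_pmf.expectation (Pi_pmf A 0 p) (\<lambda>x. (real (N x))\<^sup>2) \<le> (\<Sum>k\<in>A. q k)\<^sup>2 + (\<Sum>k\<in>A. q k)"
proof -
  have q: "0 \<le> q k" for k by (simp add: q_def)
  have "measure_pmf.expectation (Pi_pmf A 0 p) (\<lambda>x. (real (N x))\<^sup>2) =
      (\<Sum>k\<in>A. \<Sum>l\<in>A. if k = l then q k else q k * q l)"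
    unfolding card_nonzero_eq_sum power2_eq_square sum_product
    by (simp add: integrable_Pi_pmf_finite expectation_nonzero_pair)
  also have "\<dots> \<le> (\<Sum>k\<in>A. \<Sum>l\<in>A. q k * q l + (if k = l then q k else 0))"
    using q by (intro sum_mono) auto
  also have "\<dots> = (\<Sum>k\<in>A. q k)\<^sup>2 + (\<Sum>k\<in>A. q k)"
    using fin(1) by (simp add: sum.distrib power2_eq_square sum_product)
  finally show ?thesis .
qed

text \<open>The generating function for the Chernoff bound: it factorizes into terms
  \<open>1 + (t - 1) q\<close>, each at most \<open>exp ((t - 1) q)\<close>.\<close>

lemma expectation_power_card_nonzero:
  assumes "t \<ge> 1"
  shows "measure_pmf.expectation (Pi_pmf A 0 p) (\<lambda>x. t ^ N x) \<le> exp ((t - 1) * (\<Sum>k\<in>A. q k))"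
proof -
  have pw: "t ^ N x = (\<Prod>k\<in>A. 1 + (t - 1) * of_bool (x k \<noteq> 0))" for x
  proof -
    have "(\<Prod>k\<in>A. 1 + (t - 1) * of_bool (x k \<noteq> 0)) = (\<Prod>k\<in>A. if x k \<noteq> 0 then t else 1)"
      by (intro prod.cong) auto
    also have "\<dots> = t ^ N x"
      using fin(1) by (simp add: prod.If_cases N_def Int_def)
    finally show ?thesis by simp
  qed
  have "measure_pmf.expectation (Pi_pmf A 0 p) (\<lambda>x. t ^ N x) =
      (\<Prod>k\<in>A. measure_pmf.expectation (p k) (\<lambda>v. 1 + (t - 1) * of_bool (v \<noteq> 0)))"
    unfolding pw using assms by (intro expectation_Pi_pmf_prod_finite fin) auto
  also have "\<dots> = (\<Prod>k\<in>A. 1 + (t - 1) * q k)"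
    using fin(2) by (simp add: integrable_measure_pmf_finite expectation_of_bool_eq q_def)
  also have "\<dots> \<le> (\<Prod>k\<in>A. exp ((t - 1) * q k))"
    using assms by (intro prod_mono) (auto simp: q_def)
  also have "\<dots> = exp ((t - 1) * (\<Sum>k\<in>A. q k))"
    using fin(1) by (simp add: exp_sum sum_distrib_left)
  finally show ?thesis .
qed

end

text \<open>Only an inequality, because \<open>s\<close> is arbitrary and may be 0. The shift
  \<open>Suc\<close> matches vector positions from 0 with coordinates from 1.\<close>

lemma num_nonzero_round_le:
  "num_nonzero (s \<cdot>\<^sub>v vec d (\<lambda>i. x (Suc i))) \<le> card {k \<in> {1..d}. x k \<noteq> (0::real)}"
  unfolding num_nonzero_def by (rule card_inj_on_le[of Suc]) auto

text \<open>A common interface for the objective and for infeasibility: both are dominated by a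
  monotone function \<open>H\<close> of the number of nonzeros, whose law is that of independent
  entries. The inner bound holds for every value of the common sign, so averaging over the sign
  preserves it.\<close>

lemma nn_integral_round_pmf_le:
  fixes H :: "nat \<Rightarrow> real"
  assumes U: "U \<in> carrier_mat (1 + d) (1 + d)" and g: "g \<in> carrier_vec (1 + d)"
    and H: "mono H" "\<And>m. 0 \<le> H m"
    and f: "\<And>y. y \<in> carrier_vec d \<Longrightarrow> \<forall>i<d. y $ i \<in> {-1, 0, 1} \<Longrightarrow> f y \<le> ennreal (H (num_nonzero y))"
  shows "(\<integral>\<^sup>+y. f y \<partial>round_pmf d U C T g) \<le> ennreal (measure_pmf.expectation
    (Pi_pmf {1..d} 0 (\<lambda>k. sparse_entry (keep_prob C (col U k)) T (col U k \<bullet> g)))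
    (\<lambda>x. H (card {k \<in> {1..d}. x k \<noteq> 0})))" (is "_ \<le> ennreal (measure_pmf.expectation ?Pi ?H)")
proof -
  have fin: "finite (set_pmf ?Pi)"
    by (intro finite_set_Pi_pmf) (auto intro: finite_subset[OF set_sparse_entry])
  have "(\<integral>\<^sup>+x. f (sgn s \<cdot>\<^sub>v vec d (\<lambda>i. x (Suc i))) \<partial>?Pi) \<le> (\<integral>\<^sup>+x. ennreal (?H x) \<partial>?Pi)" for s
  proof (intro nn_integral_mono_AE AE_pmfI)
    fix x assume "x \<in> set_pmf ?Pi"
    then have "x k \<in> {-1, 0, 1}" if "k \<in> {1..d}" for k
      using that set_sparse_entry by (fastforce simp: set_Pi_pmf PiE_dflt_def)
    then have "x (Suc i) \<in> {-1, 0, 1}" if "i < d" for i using that by simp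
    then have "\<forall>i<d. (sgn s \<cdot>\<^sub>v vec d (\<lambda>i. x (Suc i))) $ i \<in> {-1, 0, 1}"
      by (fastforce simp: sgn_if)
    then have "f (sgn s \<cdot>\<^sub>v vec d (\<lambda>i. x (Suc i))) \<le>
        ennreal (H (num_nonzero (sgn s \<cdot>\<^sub>v vec d (\<lambda>i. x (Suc i)))))"
      by (intro f) auto
    also have "\<dots> \<le> ennreal (?H x)"
      by (intro ennreal_leI monoD[OF H(1)] num_nonzero_round_le)
    finally show "f (sgn s \<cdot>\<^sub>v vec d (\<lambda>i. x (Suc i))) \<le> ennreal (?H x)" .
  qed
  also have "(\<integral>\<^sup>+x. ennreal (?H x) \<partial>?Pi) = ennreal (measure_pmf.expectation ?Pi ?H)"
    using H(2) fin by (intro nn_integral_eq_integral integrable_measure_pmf_finite) auto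
  finally have inner: "(\<integral>\<^sup>+x. f (sgn s \<cdot>\<^sub>v vec d (\<lambda>i. x (Suc i))) \<partial>?Pi) \<le>
      ennreal (measure_pmf.expectation ?Pi ?H)" for s .
  have "(\<integral>\<^sup>+y. f y \<partial>round_pmf d U C T g) = (\<integral>\<^sup>+s. (\<integral>\<^sup>+x. f (sgn s \<cdot>\<^sub>v vec d (\<lambda>i. x (Suc i))) \<partial>?Pi)
      \<partial>sample_sign (clip (col U 0 \<bullet> g / T)))"
    unfolding round_pmf_eq[OF U g] by simp
  also have "\<dots> \<le> (\<integral>\<^sup>+s. ennreal (measure_pmf.expectation ?Pi ?H) \<partial>sample_sign (clip (col U 0 \<bullet> g / T)))"
    by (intro nn_integral_mono inner)
  also have "\<dots> = ennreal (measure_pmf.expectation ?Pi ?H)"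
    by (simp add: measure_pmf.emeasure_space_1[simplified])
  finally show ?thesis .
qed

text \<open>Makes the conditional law of the output a kernel. All outcomes come from a finite set,
  so the mass of any set is a finite sum of products of point masses, each measurable in
  \<open>g\<close>.\<close>

lemma measurable_round_pmf:
  assumes U: "U \<in> carrier_mat (1 + d) (1 + d)"
    and p: "\<And>k. k \<in> {1..d} \<Longrightarrow> keep_prob C (col U k) \<le> 1"
  shows "(\<lambda>g. measure_pmf (round_pmf d U C T (vec (1 + d) g))) \<in>
    std_gaussian (1 + d) \<rightarrow>\<^sub>M subprob_algebra (count_space UNIV)"
proof (rule measurable_subprob_algebra)
  fix A :: "real vec set"
  let ?Pi = "\<lambda>g. Pi_pmf {1..d} 0 (\<lambda>k. sparse_entry (keep_prob C (col U k)) T (col U k \<bullet> vec (1 + d) g))"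
  let ?S = "\<lambda>g. sample_sign (clip (col U 0 \<bullet> vec (1 + d) g / T))"
  let ?y = "\<lambda>s x. sgn s \<cdot>\<^sub>v vec d (\<lambda>i. x (Suc i)) :: real vec"
  \<comment> \<open>A finite set that contains the support of the entry vector for every
    \<open>g\<close> at once.\<close>
  define X where "X = PiE_dflt {1..d} 0 (\<lambda>_. {-1, 0, 1 :: real})"
  have X: "finite X" by (auto simp: X_def intro!: finite_PiE_dflt)
  have sub: "set_pmf (?Pi g) \<subseteq> X" for g
    using set_sparse_entry by (fastforce simp: X_def set_Pi_pmf PiE_dflt_def)
  have eq: "emeasure (measure_pmf (round_pmf d U C T (vec (1 + d) g))) A =
      (\<Sum>s\<in>{-1, 1}. (\<Sum>x\<in>X. indicator A (?y s x) * ennreal (pmf (?Pi g) x)) * ennreal (pmf (?S g) s))" for g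
  proof -
    have "emeasure (measure_pmf (round_pmf d U C T (vec (1 + d) g))) A =
        (\<integral>\<^sup>+y. indicator A y \<partial>round_pmf d U C T (vec (1 + d) g))" by simp
    also have "\<dots> = (\<integral>\<^sup>+s. (\<integral>\<^sup>+x. indicator A (?y s x) \<partial>?Pi g) \<partial>?S g)"
      by (subst round_pmf_eq[OF U]) simp_all
    also have "\<dots> = (\<integral>\<^sup>+s. (\<Sum>x\<in>X. indicator A (?y s x) * ennreal (pmf (?Pi g) x)) \<partial>?S g)"
      using sub X by (subst nn_integral_measure_pmf_support[of X]) auto
    also have "\<dots> = (\<Sum>s\<in>{-1, 1}. (\<Sum>x\<in>X. indicator A (?y s x) * ennreal (pmf (?Pi g) x)) * ennreal (pmf (?S g) s))"
      by (rule nn_integral_measure_pmf_support) (use set_sample_sign in auto)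
    finally show ?thesis .
  qed
  have "(\<lambda>g. pmf (?Pi g) x) \<in> borel_measurable (std_gaussian (1 + d))" for x
  proof -
    have "(\<lambda>g. pmf (sparse_entry (keep_prob C (col U k)) T (col U k \<bullet> vec (1 + d) g)) (x k))
        \<in> borel_measurable (std_gaussian (1 + d))" if "k \<in> {1..d}" for k
      by (rule measurable_compose[OF measurable_std_gaussian_scalar_prod
            measurable_pmf_sparse_entry[OF keep_prob_nonneg p[OF that]]])
    then have "(\<lambda>g. \<Prod>k\<in>{1..d}. pmf (sparse_entry (keep_prob C (col U k)) T (col U k \<bullet> vec (1 + d) g)) (x k))
        \<in> borel_measurable (std_gaussian (1 + d))" by (rule borel_measurable_prod)
    then show ?thesis
      unfolding pmf_Pi[OF finite_atLeastAtMost]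
      by (intro measurable_If borel_measurable_const sets.sets_Collect_const)
  qed
  moreover have "(\<lambda>g. pmf (?S g) s) \<in> borel_measurable (std_gaussian (1 + d))" for s
    unfolding pmf_sample_sign[OF clip_bounds(1)] by measurable
  ultimately show "(\<lambda>g. emeasure (measure_pmf (round_pmf d U C T (vec (1 + d) g))) A)
      \<in> borel_measurable (std_gaussian (1 + d))"
    unfolding eq by measurable
qed (auto intro: prob_space_imp_subprob_space measure_pmf.prob_space_axioms)

subsection \<open>Bounds for an instance\<close>

lemma sbqp_objective_abs_le:
  assumes P: "P \<in> carrier_mat d d" and c: "c \<in> carrier_vec d" and x: "x \<in> carrier_vec d"
    and P1: "\<And>i j. i < d \<Longrightarrow> j < d \<Longrightarrow> \<bar>P $$ (i, j)\<bar> \<le> 1" and c1: "\<And>i. i < d \<Longrightarrow> \<bar>c $ i\<bar> \<le> 1"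
    and tern: "\<forall>i<d. x $ i \<in> {-1, 0, 1}"
  shows "\<bar>sbqp_objective P c x\<bar> \<le> (real (num_nonzero x))\<^sup>2 + 2 * real (num_nonzero x)"
proof -
  \<comment> \<open>For entries in {-1, 0, 1} the l1 norm is the number of nonzeros.\<close>
  have N: "(\<Sum>i<d. \<bar>x $ i\<bar>) = real (num_nonzero x)"
  proof -
    have "(\<Sum>i<d. \<bar>x $ i\<bar>) = (\<Sum>i<d. if x $ i \<noteq> 0 then 1 else 0)"
      using tern by (intro sum.cong) auto
    also have "\<dots> = real (num_nonzero x)"
      using x by (simp add: sum.If_cases num_nonzero_def Int_def)
    finally show ?thesis .
  qed
  have "x \<bullet> (P *\<^sub>v x) = (\<Sum>i<d. \<Sum>j<d. x $ i * (P $$ (i, j) * x $ j))"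
    using P x by (simp add: scalar_prod_def atLeast0LessThan sum_distrib_left)
  also have "\<bar>\<dots>\<bar> \<le> (\<Sum>i<d. \<Sum>j<d. \<bar>x $ i\<bar> * \<bar>x $ j\<bar>)"
  proof (intro order_trans[OF sum_abs] sum_mono)
    fix i j assume "i \<in> {..<d}" "j \<in> {..<d}"
    then have "\<bar>P $$ (i, j)\<bar> * \<bar>x $ j\<bar> \<le> \<bar>x $ j\<bar>"
      using P1[of i j] by (intro mult_left_le_one_le) auto
    then show "\<bar>x $ i * (P $$ (i, j) * x $ j)\<bar> \<le> \<bar>x $ i\<bar> * \<bar>x $ j\<bar>"
      unfolding abs_mult by (intro mult_left_mono) auto
  qed
  also have "\<dots> = (real (num_nonzero x))\<^sup>2"
    by (simp add: power2_eq_square sum_product N[symmetric])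
  finally have 1: "\<bar>x \<bullet> (P *\<^sub>v x)\<bar> \<le> (real (num_nonzero x))\<^sup>2" .
  have "c \<bullet> x = (\<Sum>i<d. c $ i * x $ i)"
    using x by (simp add: scalar_prod_def atLeast0LessThan)
  also have "\<bar>\<dots>\<bar> \<le> (\<Sum>i<d. \<bar>x $ i\<bar>)"
    using c1 by (intro order_trans[OF sum_abs] sum_mono) (auto simp: abs_mult intro!: mult_left_le_one_le)
  finally have "\<bar>c \<bullet> x\<bar> \<le> real (num_nonzero x)" by (simp add: N)
  with 1 show ?thesis unfolding sbqp_objective_def by linarith
qed

lemma Q_mat_carrier:
  assumes "P \<in> carrier_mat d d" "c \<in> carrier_vec d"
  shows "Q_mat c P \<in> carrier_mat (1 + d) (1 + d)"
  unfolding Q_mat_def using assms by (intro four_block_carrier_mat) auto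

lemma sbqp_instance_entries:
  assumes inst: "sbqp_instance d \<sigma> P c"
  shows "i < d \<Longrightarrow> j < d \<Longrightarrow> \<bar>P $$ (i, j)\<bar> \<le> 1" "i < d \<Longrightarrow> \<bar>c $ i\<bar> \<le> 1"
proof -
  have P: "P \<in> carrier_mat d d" and c: "c \<in> carrier_vec d" and 1: "max_abs_entry (Q_mat c P) \<le> 1"
    using inst by (auto simp: sbqp_instance_def)
  have Q: "\<bar>Q_mat c P $$ (i, j)\<bar> \<le> 1" if "i < 1 + d" "j < 1 + d" for i j
  proof -
    have "Q_mat c P $$ (i, j) \<in> elements_mat (Q_mat c P)"
      using Q_mat_carrier[OF P c] that by blast
    moreover have "finite (elements_mat (Q_mat c P))"
      by (simp add: elements_mat_def)
    ultimately have "\<bar>Q_mat c P $$ (i, j)\<bar> \<le> max_abs_entry (Q_mat c P)"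
      unfolding max_abs_entry_def by (intro Max_ge) auto
    then show ?thesis using 1 by simp
  qed
  \<comment> \<open>Row and column 0 of \<open>Q_mat\<close> hold \<open>- c\<close>, hence the
    shift of indices by one.\<close>
  show "i < d \<Longrightarrow> j < d \<Longrightarrow> \<bar>P $$ (i, j)\<bar> \<le> 1"
    using Q[of "Suc i" "Suc j"] P c by (simp add: Q_mat_def)
  show "i < d \<Longrightarrow> \<bar>c $ i\<bar> \<le> 1"
    using Q[of 0 "Suc i"] P c by (simp add: Q_mat_def mat_of_rows_def)
qed

text \<open>Ensures that the optimal value divided by the square of the threshold cannot be far
  below 0.\<close>

lemma sbqp_optimal_ge:
  assumes inst: "sbqp_instance d \<sigma> P c" and opt: "sbqp_optimal d \<sigma> P c x"
  shows "- ((real \<sigma>)\<^sup>2 + 2 * real \<sigma>) \<le> sbqp_objective P c x"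
proof -
  have x: "x \<in> carrier_vec d" "\<forall>i<d. x $ i \<in> {-1, 0, 1}" "num_nonzero x \<le> \<sigma>"
    using opt by (auto simp: sbqp_optimal_def sbqp_feasible_def)
  have "\<bar>sbqp_objective P c x\<bar> \<le> (real (num_nonzero x))\<^sup>2 + 2 * real (num_nonzero x)"
    using inst x(1,2) by (intro sbqp_objective_abs_le[of _ d] sbqp_instance_entries[OF inst])
      (auto simp: sbqp_instance_def)
  also have "\<dots> \<le> (real \<sigma>)\<^sup>2 + 2 * real \<sigma>"
    using x(3) by (intro add_mono power_mono mult_left_mono) auto
  finally show ?thesis by linarith
qed

lemma sdp_feasibleD:
  assumes W: "W \<in> sdp_feasible d \<sigma>"
  shows "W \<in> carrier_mat (1 + d) (1 + d)" "psd_mat W"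
    and "k < 1 + d \<Longrightarrow> W $$ (k, k) \<le> 1" "(\<Sum>k\<in>{1..d}. W $$ (k, k)) \<le> real \<sigma>"
proof -
  show c: "W \<in> carrier_mat (1 + d) (1 + d)" and "psd_mat W"
    using W by (auto simp: sdp_feasible_def)
  have sub: "W_sub W $$ (i, j) = W $$ (Suc i, Suc j)" if "i < d" "j < d" for i j
    using c that by (simp add: mat_delete_def)
  show "W $$ (k, k) \<le> 1" if "k < 1 + d"
    using W that sub by (cases k) (auto simp: sdp_feasible_def)
  have "mat_trace (W_sub W) = (\<Sum>i<d. W $$ (Suc i, Suc i))"
    using c by (simp add: mat_trace_def sub)
  also have "\<dots> = (\<Sum>k\<in>{1..d}. W $$ (k, k))"
    by (rule sum.reindex_bij_witness[of _ "\<lambda>k. k - 1" Suc]) auto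
  finally show "(\<Sum>k\<in>{1..d}. W $$ (k, k)) \<le> real \<sigma>"
    using W by (simp add: sdp_feasible_def)
qed

text \<open>In the Gram representation the diagonal constraints bound the squared column norms by 1,
  which controls all mixed products.\<close>

lemma sdp_feasible_entry_le:
  assumes W: "W \<in> sdp_feasible d \<sigma>" and ij: "i < 1 + d" "j < 1 + d"
  shows "\<bar>W $$ (i, j)\<bar> \<le> 1"
proof -
  note D = sdp_feasibleD[OF W]
  let ?U = "psd_sqrt W"
  note U = psd_sqrt_works[OF D(1,2)]
  have "W $$ (i, j) = col ?U i \<bullet> col ?U j" by (rule psd_sqrt_entry[OF D(1,2) ij])
  also have "\<bar>\<dots>\<bar> \<le> (col ?U i \<bullet> col ?U i + col ?U j \<bullet> col ?U j) / 2"
    by (rule abs_scalar_prod_le[OF col_carrier_vec[OF ij(1) U(1)] col_carrier_vec[OF ij(2) U(1)]])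
  also have "\<dots> = (W $$ (i, i) + W $$ (j, j)) / 2"
    using psd_sqrt_col_norm[OF D(1,2) ij(1)] psd_sqrt_col_norm[OF D(1,2) ij(2)]
    by (simp add: l2_norm_vec_def scalar_prod_real_self_nonneg)
  also have "\<dots> \<le> 1" using D(3)[OF ij(1)] D(3)[OF ij(2)] by simp
  finally show ?thesis .
qed

text \<open>The value at \<open>W\<close> is at least the infimum, so the allowed gap cannot be
  negative. This lets the error term be dropped from the lower bound on the right-hand side.\<close>

lemma sdp_eps_optimal_nonneg:
  assumes P: "P \<in> carrier_mat d d" and c: "c \<in> carrier_vec d"
    and opt: "sdp_eps_optimal d \<sigma> c P \<epsilon> W"
  shows "0 \<le> \<epsilon>"
proof -
  let ?Q = "Q_mat c P"
  have Q: "?Q \<in> carrier_mat (1 + d) (1 + d)" by (rule Q_mat_carrier[OF P c])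
  \<comment> \<open>A real \<open>INF\<close> is a lower bound only if the set of values is bounded
    below; here feasible matrices have entries of absolute value at most 1.\<close>
  have "bdd_below (sdp_objective c P ` sdp_feasible d \<sigma>)"
  proof (rule bdd_belowI2)
    fix V assume V: "V \<in> sdp_feasible d \<sigma>"
    have "sdp_objective c P V = (\<Sum>i<1+d. \<Sum>j<1+d. ?Q $$ (i, j) * V $$ (j, i))"
      using Q sdp_feasibleD(1)[OF V]
      by (simp add: sdp_objective_def mat_trace_def scalar_prod_def atLeast0LessThan del: sum.lessThan_Suc)
    moreover have "(\<Sum>i<1+d. \<Sum>j<1+d. - \<bar>?Q $$ (i, j)\<bar>) \<le> \<dots>"
    proof (intro sum_mono)
      fix i j assume "i \<in> {..<1+d}" "j \<in> {..<1+d}"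
      then have "\<bar>?Q $$ (i, j) * V $$ (j, i)\<bar> \<le> \<bar>?Q $$ (i, j)\<bar>"
        using sdp_feasible_entry_le[OF V, of j i] by (auto simp: abs_mult intro!: mult_left_le)
      then show "- \<bar>?Q $$ (i, j)\<bar> \<le> ?Q $$ (i, j) * V $$ (j, i)" by linarith
    qed
    ultimately show "(\<Sum>i<1+d. \<Sum>j<1+d. - \<bar>?Q $$ (i, j)\<bar>) \<le> sdp_objective c P V" by simp
  qed
  then have "sdp_value d \<sigma> c P \<le> sdp_objective c P W"
    unfolding sdp_value_def using opt by (intro cINF_lower) (auto simp: sdp_eps_optimal_def)
  then show ?thesis using opt by (simp add: sdp_eps_optimal_def)
qed

section \<open>Expected objective and feasibility for a single instance\<close>

lemma integral_le_nn_integral_abs: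
  fixes f :: "'a \<Rightarrow> real"
  assumes "(\<integral>\<^sup>+x. ennreal \<bar>f x\<bar> \<partial>M) \<le> ennreal B" "0 \<le> B"
  shows "integral\<^sup>L M f \<le> B"
proof (cases "integrable M f")
  case True
  have "integral\<^sup>L M f \<le> (\<integral>x. \<bar>f x\<bar> \<partial>M)"
    using True by (intro integral_mono) auto
  also have "ennreal (\<integral>x. \<bar>f x\<bar> \<partial>M) \<le> ennreal B"
    using True assms(1) by (subst nn_integral_eq_integral[symmetric]) auto
  then have "(\<integral>x. \<bar>f x\<bar> \<partial>M) \<le> B" using assms(2) by simp
  finally show ?thesis .
\<comment> \<open>A function that is not integrable has integral 0 by convention, which
  \<open>0 <= B\<close> covers.\<close>
qed (use assms(2) in \<open>simp add: not_integrable_integral_eq\<close>)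

locale rounding =
  fixes d \<sigma> :: nat and P :: "real mat" and c :: "real vec" and W :: "real mat" and C T :: real
  assumes inst: "sbqp_instance d \<sigma> P c" and W: "W \<in> sdp_feasible d \<sigma>"
    and C: "0 < C" and T: "0 \<le> T"
begin

abbreviation "u k \<equiv> col (psd_sqrt W) k"
abbreviation "p k \<equiv> keep_prob C (u k)"
abbreviation "gaussian \<equiv> std_gaussian (1 + d)"
abbreviation "output g \<equiv> measure_pmf (round_pmf d (psd_sqrt W) C T (vec (1 + d) g))"
abbreviation "entry g k \<equiv> sparse_entry (p k) T (u k \<bullet> vec (1 + d) g)"
abbreviation "q g k \<equiv> measure (entry g k) {x. x \<noteq> 0}"

text \<open>Since \<open>C > 0\<close>, these are exactly the indices whose column has norm at least
  \<open>C\<close>.\<close>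

definition kept :: "nat set" where
  "kept = {k \<in> {1..d}. p k \<noteq> 0}"

text \<open>The scale that bounds the root mean square over \<open>g\<close> of the conditional
  expected number of nonzeros.\<close>

definition ratio :: real where
  "ratio = real \<sigma> / (C * T)"

lemma sqrt_carrier: "psd_sqrt W \<in> carrier_mat (1 + d) (1 + d)"
  by (rule psd_sqrt_works[OF sdp_feasibleD(1,2)[OF W]])

lemma u_carrier: "k \<in> {1..d} \<Longrightarrow> u k \<in> carrier_vec (1 + d)"
  using sqrt_carrier by (intro col_carrier_vec) auto

lemma u_norm: "k \<in> {1..d} \<Longrightarrow> (l2_norm_vec (u k))\<^sup>2 = W $$ (k, k)"
  by (rule psd_sqrt_col_norm[OF sdp_feasibleD(1,2)[OF W]]) auto

lemma W_diag_nonneg: "k \<in> {1..d} \<Longrightarrow> 0 \<le> W $$ (k, k)"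
  using u_norm[of k] by (metis zero_le_power2)

lemma p_le: "k \<in> {1..d} \<Longrightarrow> p k \<le> 2 / 3 * W $$ (k, k)"
  using u_norm[of k] W_diag_nonneg[of k] by (simp add: keep_prob_def)

lemma p_le_1: "k \<in> {1..d} \<Longrightarrow> p k \<le> 1"
  using p_le[of k] sdp_feasibleD(3)[OF W, of k] by simp

text \<open>The factor 2/3 in the keep probability, together with the trace constraint, leaves a
  margin of a third of \<open>\<sigma>\<close> below the sparsity budget, for every
  \<open>g\<close>.\<close>

lemma sum_q_le: "(\<Sum>k\<in>{1..d}. q g k) \<le> 2 / 3 * real \<sigma>"
proof -
  have "(\<Sum>k\<in>{1..d}. q g k) \<le> (\<Sum>k\<in>{1..d}. 2 / 3 * W $$ (k, k))"
    by (intro sum_mono order_trans[OF prob_sparse_entry_nonzero(1) p_le] keep_prob_nonneg p_le_1 T)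
  also have "\<dots> \<le> 2 / 3 * real \<sigma>"
    using sdp_feasibleD(4)[OF W] unfolding sum_distrib_left[symmetric] by simp
  finally show ?thesis .
qed

lemma sum_q_le_kept: "(\<Sum>k\<in>{1..d}. q g k) \<le> (\<Sum>k\<in>kept. \<bar>u k \<bullet> vec (1 + d) g\<bar>) / T"
proof -
  have "(\<Sum>k\<in>{1..d}. q g k) \<le> (\<Sum>k\<in>{1..d}. if p k = 0 then 0 else \<bar>u k \<bullet> vec (1 + d) g\<bar> / T)"
    by (intro sum_mono prob_sparse_entry_nonzero(2) keep_prob_nonneg p_le_1 T)
  also have "\<dots> = (\<Sum>k\<in>kept. \<bar>u k \<bullet> vec (1 + d) g\<bar> / T)"
    unfolding kept_def by (rule sum.mono_neutral_cong_right) auto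
  finally show ?thesis by (simp add: sum_divide_distrib)
qed

lemma finite_kept: "finite kept"
  by (simp add: kept_def)

lemma sum_kept_norm_le: "(\<Sum>k\<in>kept. u k \<bullet> u k) \<le> real \<sigma>"
proof -
  have "(\<Sum>k\<in>kept. u k \<bullet> u k) \<le> (\<Sum>k\<in>{1..d}. u k \<bullet> u k)"
    by (rule sum_mono2) (auto simp: kept_def scalar_prod_real_self_nonneg)
  also have "\<dots> = (\<Sum>k\<in>{1..d}. W $$ (k, k))"
    using u_norm by (intro sum.cong) (simp_all add: l2_norm_vec_def scalar_prod_real_self_nonneg)
  finally show ?thesis using sdp_feasibleD(4)[OF W] by simp
qed

text \<open>Every kept column uses up at least the square of \<open>C\<close> of the trace
  budget.\<close>

lemma card_kept_le: "real (card kept) * C\<^sup>2 \<le> real \<sigma>"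
proof -
  have "real (card kept) * C\<^sup>2 = (\<Sum>k\<in>kept. C\<^sup>2)" by simp
  also have "\<dots> \<le> (\<Sum>k\<in>kept. u k \<bullet> u k)"
  proof (rule sum_mono)
    fix k assume "k \<in> kept"
    then have "C \<le> l2_norm_vec (u k)" by (auto simp: kept_def keep_prob_def split: if_splits)
    then have "C\<^sup>2 \<le> (l2_norm_vec (u k))\<^sup>2" using C by (intro power_mono) auto
    then show "C\<^sup>2 \<le> u k \<bullet> u k" by (simp add: l2_norm_vec_def scalar_prod_real_self_nonneg)
  qed
  also note sum_kept_norm_le
  finally show ?thesis .
qed

lemma finite_set_entry: "finite (set_pmf (entry g k))"
  by (rule finite_subset[OF set_sparse_entry]) simp

lemma measurable_output: "output \<in> gaussian \<rightarrow>\<^sub>M subprob_algebra (count_space UNIV)"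
  using measurable_round_pmf[OF sqrt_carrier p_le_1] .

lemma algorithm1_eq: "algorithm1 W C T = gaussian \<bind> output"
  using sdp_feasibleD(1)[OF W] by (simp add: algorithm1_def)

lemma nn_integral_algorithm1:
  "(\<integral>\<^sup>+y. f y \<partial>algorithm1 W C T) = (\<integral>\<^sup>+g. (\<integral>\<^sup>+y. f y \<partial>output g) \<partial>gaussian)"
  unfolding algorithm1_eq by (rule nn_integral_bind[OF _ measurable_output]) simp

lemma sets_algorithm1: "sets (algorithm1 W C T) = UNIV"
proof -
  have "sets (algorithm1 W C T) = sets (count_space UNIV)"
    unfolding algorithm1_eq
  proof (rule sets_bind)
    show "space gaussian \<noteq> {}" using prob_space_std_gaussian by (rule prob_space.not_empty)
  qed simp
  then show ?thesis by simp
qed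

lemma prob_space_algorithm1: "prob_space (algorithm1 W C T)"
  unfolding algorithm1_eq
  by (rule prob_space.prob_space_bind[OF prob_space_std_gaussian _ measurable_output])
    (simp add: measure_pmf.prob_space_axioms)

text \<open>\<open>A g\<close> dominates the conditional mean \<open>Q\<close> of the number
  \<open>N\<close> of nonzeros, and the second moment of \<open>N\<close> is at most
  \<open>Q^2 + Q\<close>; hence the mean of \<open>N^2 + 2 N\<close> is at most
  \<open>Q^2 + 3 Q\<close>.\<close>

lemma nn_integral_objective_output_le:
  defines "A \<equiv> \<lambda>g. (\<Sum>k\<in>kept. \<bar>u k \<bullet> vec (1 + d) g\<bar>) / T"
  shows "(\<integral>\<^sup>+y. ennreal \<bar>sbqp_objective P c y\<bar> \<partial>output g) \<le> ennreal ((A g)\<^sup>2 + 3 * A g)"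
proof -
  let ?N = "\<lambda>x. card {k \<in> {1..d}. x k \<noteq> (0::real)}"
  let ?Pi = "Pi_pmf {1..d} 0 (entry g)"
  let ?Q = "\<Sum>k\<in>{1..d}. q g k"
  have PC: "P \<in> carrier_mat d d" "c \<in> carrier_vec d"
    using inst by (auto simp: sbqp_instance_def)
  have "(\<integral>\<^sup>+y. ennreal \<bar>sbqp_objective P c y\<bar> \<partial>output g) \<le>
      ennreal (measure_pmf.expectation ?Pi (\<lambda>x. (real (?N x))\<^sup>2 + 2 * real (?N x)))"
  proof (rule nn_integral_round_pmf_le[OF sqrt_carrier, where H = "\<lambda>m. (real m)\<^sup>2 + 2 * real m"])
    show "mono (\<lambda>m. (real m)\<^sup>2 + 2 * real m)" by (intro monoI add_mono power_mono) auto
    fix y :: "real vec" assume "y \<in> carrier_vec d" "\<forall>i<d. y $ i \<in> {-1, 0, 1}"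
    then show "ennreal \<bar>sbqp_objective P c y\<bar> \<le> ennreal ((real (num_nonzero y))\<^sup>2 + 2 * real (num_nonzero y))"
      by (intro ennreal_leI sbqp_objective_abs_le[OF PC] sbqp_instance_entries[OF inst])
  qed auto
  also have "\<dots> \<le> ennreal ((A g)\<^sup>2 + 3 * A g)"
  proof (rule ennreal_leI)
    have int: "integrable ?Pi f" for f :: "_ \<Rightarrow> real"
      by (intro integrable_measure_pmf_finite finite_set_Pi_pmf finite_set_entry) simp
    have "measure_pmf.expectation ?Pi (\<lambda>x. (real (?N x))\<^sup>2 + 2 * real (?N x)) =
        measure_pmf.expectation ?Pi (\<lambda>x. (real (?N x))\<^sup>2) + 2 * measure_pmf.expectation ?Pi (\<lambda>x. real (?N x))"
      by (subst Bochner_Integration.integral_add[OF int int]) simp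
    also have "\<dots> \<le> ?Q\<^sup>2 + ?Q + 2 * ?Q"
      using expectation_card_nonzero_square[of "{1..d}" "entry g"] expectation_card_nonzero[of "{1..d}" "entry g"]
        finite_set_entry by (intro add_mono) auto
    also have "\<dots> \<le> (A g)\<^sup>2 + A g + 2 * A g"
      unfolding A_def
      by (intro add_mono power_mono sum_q_le_kept mult_left_mono sum_nonneg) auto
    finally show "measure_pmf.expectation ?Pi (\<lambda>x. (real (?N x))\<^sup>2 + 2 * real (?N x)) \<le> (A g)\<^sup>2 + 3 * A g"
      by simp
  qed
  finally show ?thesis .
qed

text \<open>By Cauchy-Schwarz and the Gaussian second moments, \<open>A\<close> squared has mean at
  most \<open>card kept / T^2\<close> times the sum of the squared kept norms. The two factors are
  controlled by \<open>\<sigma> / C^2\<close> and by \<open>\<sigma>\<close>, which gives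
  \<open>ratio^2\<close>.\<close>

lemma expectation_objective_le:
  "(\<integral>y. sbqp_objective P c y \<partial>algorithm1 W C T) \<le> ratio\<^sup>2 + 3 * ratio"
proof (rule integral_le_nn_integral_abs)
  show "0 \<le> ratio\<^sup>2 + 3 * ratio" using C T by (simp add: ratio_def)
  define A where "A g = (\<Sum>k\<in>kept. \<bar>u k \<bullet> vec (1 + d) g\<bar>) / T" for g
  have "(\<integral>\<^sup>+y. ennreal \<bar>sbqp_objective P c y\<bar> \<partial>algorithm1 W C T) \<le>
      (\<integral>\<^sup>+g. ennreal ((A g)\<^sup>2 + 3 * A g) \<partial>gaussian)"
    unfolding nn_integral_algorithm1 A_def by (intro nn_integral_mono nn_integral_objective_output_le)
  also have "\<dots> \<le> ennreal (ratio\<^sup>2 + 3 * ratio)"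
  \<comment> \<open>At \<open>T = 0\<close> division by zero makes \<open>A\<close> vanish
    identically.\<close>
  proof (cases "T = 0")
    case True
    then show ?thesis by (simp add: A_def)
  next
    case False
    then have T0: "T > 0" using T by simp
    have "\<sigma> > 0" using inst by (simp add: sbqp_instance_def)
    then have r: "ratio > 0" using C T0 by (simp add: ratio_def)
    \<comment> \<open>The linear term \<open>3 A\<close> is split as \<open>3 / 2 ratio\<close> plus
      \<open>3 / (2 ratio)\<close> times \<open>A\<close> squared; \<open>a\<close> collects
      everything in front of the sum of squares. With the mean of \<open>A\<close> squared at most
      \<open>ratio^2\<close>, the total is \<open>ratio^2 + 3 ratio\<close>.\<close>
    define a where "a = (1 + 3 / (2 * ratio)) * (real (card kept) / T\<^sup>2)"
    have a: "a \<ge> 0" using r by (simp add: a_def)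
    \<comment> \<open>Cauchy-Schwarz over \<open>kept\<close>, and \<open>2 A \<le> ratio + A\<^sup>2 / ratio\<close>\<close>
    have le: "(A g)\<^sup>2 + 3 * A g \<le> a * (\<Sum>k\<in>kept. (u k \<bullet> vec (1 + d) g)\<^sup>2) + 3 / 2 * ratio" for g
    proof -
      have "0 \<le> (A g - ratio)\<^sup>2 / ratio" using r by simp
      also have "\<dots> = (A g)\<^sup>2 / ratio - 2 * A g + ratio"
        using r by (simp add: power2_eq_square field_simps)
      finally have "(A g)\<^sup>2 + 3 * A g \<le> (1 + 3 / (2 * ratio)) * (A g)\<^sup>2 + 3 / 2 * ratio"
        using r by (simp add: distrib_right)
      moreover have "(A g)\<^sup>2 \<le> real (card kept) / T\<^sup>2 * (\<Sum>k\<in>kept. (u k \<bullet> vec (1 + d) g)\<^sup>2)"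
        using sum_squared_le_sum_of_squares[of "\<lambda>k. \<bar>u k \<bullet> vec (1 + d) g\<bar>" kept] finite_kept T0
        by (simp add: A_def power_divide divide_right_mono mult.commute)
      then have "(1 + 3 / (2 * ratio)) * (A g)\<^sup>2 \<le> a * (\<Sum>k\<in>kept. (u k \<bullet> vec (1 + d) g)\<^sup>2)"
        unfolding a_def mult.assoc using r by (intro mult_left_mono) auto
      ultimately show ?thesis by linarith
    qed
    interpret gaussian: prob_space gaussian by (rule prob_space_std_gaussian)
    have const: "has_bochner_integral gaussian (\<lambda>_. 3 / 2 * ratio) (3 / 2 * ratio)"
      by (simp only: has_bochner_integral_iff gaussian.integrable_const lebesgue_integral_const
          gaussian.prob_space scaleR_one simp_thms)
    have bi: "has_bochner_integral gaussian
        (\<lambda>g. a * (\<Sum>k\<in>kept. (u k \<bullet> vec (1 + d) g)\<^sup>2) + 3 / 2 * ratio)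
        (a * (\<Sum>k\<in>kept. u k \<bullet> u k) + 3 / 2 * ratio)"
      by (intro has_bochner_integral_add has_bochner_integral_mult_right has_bochner_integral_sum
          std_gaussian_second_moment u_carrier const) (simp add: kept_def)
    have "(\<integral>\<^sup>+g. ennreal ((A g)\<^sup>2 + 3 * A g) \<partial>gaussian) \<le>
        (\<integral>\<^sup>+g. ennreal (a * (\<Sum>k\<in>kept. (u k \<bullet> vec (1 + d) g)\<^sup>2) + 3 / 2 * ratio) \<partial>gaussian)"
      by (intro nn_integral_mono ennreal_leI le)
    also have "\<dots> = ennreal (a * (\<Sum>k\<in>kept. u k \<bullet> u k) + 3 / 2 * ratio)"
      using bi a r by (subst nn_integral_eq_integral)
        (auto simp: has_bochner_integral_iff intro!: AE_I2 add_nonneg_nonneg mult_nonneg_nonneg sum_nonneg)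
    also have "a * (\<Sum>k\<in>kept. u k \<bullet> u k) + 3 / 2 * ratio \<le> ratio\<^sup>2 + 3 * ratio"
    proof -
      have "real (card kept) \<le> real \<sigma> / C\<^sup>2"
        using card_kept_le C by (simp add: field_simps)
      then have "real (card kept) / T\<^sup>2 * (\<Sum>k\<in>kept. u k \<bullet> u k) \<le> real \<sigma> / C\<^sup>2 / T\<^sup>2 * real \<sigma>"
        using sum_kept_norm_le
        by (intro mult_mono divide_right_mono) (auto intro!: sum_nonneg scalar_prod_real_self_nonneg)
      also have "\<dots> = ratio\<^sup>2" by (simp add: ratio_def power2_eq_square)
      finally have "a * (\<Sum>k\<in>kept. u k \<bullet> u k) \<le> (1 + 3 / (2 * ratio)) * ratio\<^sup>2"
        unfolding a_def mult.assoc using r by (intro mult_left_mono) auto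
      also have "\<dots> = ratio\<^sup>2 + 3 / 2 * ratio"
        using r by (simp add: distrib_right power2_eq_square)
      finally show ?thesis by simp
    qed
    finally show ?thesis by (simp add: ennreal_leI)
  qed
  finally show "(\<integral>\<^sup>+y. ennreal \<bar>sbqp_objective P c y\<bar> \<partial>algorithm1 W C T) \<le> ennreal (ratio\<^sup>2 + 3 * ratio)" .
qed

text \<open>Ternary outputs are infeasible only if more than \<open>\<sigma>\<close> entries are
  nonzero. Markov's inequality for the power \<open>(5 / 4) ^ N\<close> and \<open>sum_q_le\<close>
  give the exponent: 1/6 is (5/4 - 1) times 2/3.\<close>

lemma prob_feasible_ge:
  "1 - exp (- (ln (5 / 4) - 1 / 6) * real \<sigma>) \<le> measure (algorithm1 W C T) (sbqp_feasible d \<sigma>)"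
proof -
  let ?F = "sbqp_feasible d \<sigma>" and ?e = "exp (- (ln (5 / 4) - 1 / 6) * real \<sigma>)"
  let ?N = "\<lambda>x. card {k \<in> {1..d}. x k \<noteq> (0::real)}"
  interpret prob_space "algorithm1 W C T" by (rule prob_space_algorithm1)
  have "(\<integral>\<^sup>+y. indicator (- ?F) y \<partial>output g) \<le> ennreal ?e" for g
  proof -
    let ?Pi = "Pi_pmf {1..d} 0 (entry g)"
    have "(\<integral>\<^sup>+y. indicator (- ?F) y \<partial>output g) \<le>
        ennreal (measure_pmf.expectation ?Pi (\<lambda>x. (5 / 4 :: real) ^ ?N x / (5 / 4) ^ \<sigma>))"
    proof (rule nn_integral_round_pmf_le[OF sqrt_carrier, where H = "\<lambda>m. (5 / 4) ^ m / (5 / 4) ^ \<sigma>"])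
      show "mono (\<lambda>m. (5 / 4 :: real) ^ m / (5 / 4) ^ \<sigma>)"
        by (intro monoI divide_right_mono power_increasing) auto
      fix y :: "real vec" assume y: "y \<in> carrier_vec d" "\<forall>i<d. y $ i \<in> {-1, 0, 1}"
      show "indicator (- ?F) y \<le> ennreal ((5 / 4) ^ num_nonzero y / (5 / 4) ^ \<sigma>)"
      proof (cases "num_nonzero y \<le> \<sigma>")
        case True
        then show ?thesis using y by (simp add: sbqp_feasible_def)
      next
        case False
        then have "(5 / 4 :: real) ^ \<sigma> \<le> (5 / 4) ^ num_nonzero y"
          by (intro power_increasing) auto
        then have "1 \<le> (5 / 4 :: real) ^ num_nonzero y / (5 / 4) ^ \<sigma>" by simp
        then have "1 \<le> ennreal ((5 / 4) ^ num_nonzero y / (5 / 4) ^ \<sigma>)" by simp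
        then show ?thesis by (rule order_trans[rotated]) (simp split: split_indicator)
      qed
    qed auto
    also have "\<dots> \<le> ennreal ?e"
    proof (rule ennreal_leI)
      have "measure_pmf.expectation ?Pi (\<lambda>x. (5 / 4 :: real) ^ ?N x / (5 / 4) ^ \<sigma>) =
          measure_pmf.expectation ?Pi (\<lambda>x. (5 / 4 :: real) ^ ?N x) / (5 / 4) ^ \<sigma>" by simp
      also have "\<dots> \<le> exp ((5 / 4 - 1) * (\<Sum>k\<in>{1..d}. q g k)) / (5 / 4) ^ \<sigma>"
        using expectation_power_card_nonzero[of "{1..d}" "entry g" "5 / 4"] finite_set_entry
        by (intro divide_right_mono) auto
      also have "\<dots> \<le> exp (real \<sigma> / 6) / (5 / 4) ^ \<sigma>"
        using sum_q_le[of g] by (intro divide_right_mono) auto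
      also have "\<dots> = exp (real \<sigma> / 6) / exp (real \<sigma> * ln (5 / 4))"
        by (simp add: exp_of_nat_mult)
      also have "\<dots> = ?e"
        by (simp add: exp_diff[symmetric] algebra_simps)
      finally show "measure_pmf.expectation ?Pi (\<lambda>x. (5 / 4 :: real) ^ ?N x / (5 / 4) ^ \<sigma>) \<le> ?e" .
    qed
    finally show ?thesis .
  qed
  then have "(\<integral>\<^sup>+g. (\<integral>\<^sup>+y. indicator (- ?F) y \<partial>output g) \<partial>gaussian) \<le> (\<integral>\<^sup>+g. ennreal ?e \<partial>gaussian)"
    by (intro nn_integral_mono)
  also have "\<dots> = ennreal ?e"
    by (simp add: prob_space.emeasure_space_1[OF prob_space_std_gaussian])
  finally have "emeasure (algorithm1 W C T) (- ?F) \<le> ennreal ?e"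
    by (simp only: nn_integral_algorithm1[symmetric] nn_integral_indicator sets_algorithm1 UNIV_I)
  then have "prob (- ?F) \<le> ?e"
    by (simp add: emeasure_eq_measure)
  moreover have "prob (- ?F) = 1 - prob ?F"
    using prob_compl[of ?F] sets_algorithm1 sets_eq_imp_space_eq[of "algorithm1 W C T" "count_space UNIV"]
    by (simp add: Compl_eq_Diff_UNIV)
  ultimately show ?thesis by simp
qed

end

section \<open>Passage to the limit along a sequence of instances\<close>

lemma asymp_approxI:
  fixes T :: "nat \<Rightarrow> real"
  assumes C_pos: "0 < C"
    and instances: "\<And>n. sbqp_instance (d n) (\<sigma> n) (P n) (c n)"
    and sdp: "\<And>n. sdp_eps_optimal (d n) (\<sigma> n) (c n) (P n) (\<epsilon> n) (W n)"
    and optimal: "\<And>n. sbqp_optimal (d n) (\<sigma> n) (P n) (c n) (xopt n)"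
    and T_nonneg: "\<And>n. 0 \<le> T n"
    and lim: "(\<lambda>n. real (\<sigma> n) / T n) \<longlonglongrightarrow> 0"
  shows "asymp_approx_in_expectation (\<lambda>n. 1 / (T n)\<^sup>2) P c \<epsilon> xopt (\<lambda>n. algorithm1 (W n) C (T n))"
proof -
  define s where "s n = real (\<sigma> n) / T n" for n
  \<comment> \<open>The first two terms bound the expected objective. The last one compensates a
    negative right-hand side, which is at least \<open>- 3 (s n)^2\<close> because
    \<open>\<sigma>^2 + 2 \<sigma>\<close> is at most \<open>3 \<sigma>^2\<close>.\<close>
  define r where "r n = (s n / C)\<^sup>2 + 3 * (s n / C) + 3 * (s n)\<^sup>2" for n
  have "r \<longlonglongrightarrow> (0 / C)\<^sup>2 + 3 * (0 / C) + 3 * 0\<^sup>2"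
    unfolding r_def using lim C_pos by (intro tendsto_intros) (auto simp: s_def)
  then have "r \<in> o(\<lambda>_. 1)" by (intro smalloI_tendsto) auto
  moreover have "(\<integral>x. sbqp_objective (P n) (c n) x \<partial>algorithm1 (W n) C (T n)) \<le>
      1 / (T n)\<^sup>2 * (sbqp_objective (P n) (c n) (xopt n) + \<epsilon> n) + r n" for n
  proof -
    interpret rounding "d n" "\<sigma> n" "P n" "c n" "W n" C "T n"
      using instances[of n] sdp[of n] C_pos T_nonneg[of n] by unfold_locales (auto simp: sdp_eps_optimal_def)
    have \<sigma>: "\<sigma> n \<ge> 1" and "P n \<in> carrier_mat (d n) (d n)" "c n \<in> carrier_vec (d n)"
      using instances[of n] by (auto simp: sbqp_instance_def)
    then have "0 \<le> \<epsilon> n" using sdp_eps_optimal_nonneg[OF _ _ sdp] by blast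
    moreover have "real (\<sigma> n) \<le> (real (\<sigma> n))\<^sup>2" using \<sigma> by (simp add: power2_eq_square)
    ultimately have "- 3 * (real (\<sigma> n))\<^sup>2 \<le> sbqp_objective (P n) (c n) (xopt n) + \<epsilon> n"
      using sbqp_optimal_ge[OF instances[of n] optimal[of n]] by linarith
    then have "1 / (T n)\<^sup>2 * (- 3 * (real (\<sigma> n))\<^sup>2) \<le> 1 / (T n)\<^sup>2 * (sbqp_objective (P n) (c n) (xopt n) + \<epsilon> n)"
      by (intro mult_left_mono) auto
    moreover have "1 / (T n)\<^sup>2 * (- 3 * (real (\<sigma> n))\<^sup>2) = - 3 * (s n)\<^sup>2"
      by (simp add: s_def power_divide)
    moreover have "ratio = s n / C" by (simp add: ratio_def s_def)
    ultimately show ?thesis using expectation_objective_le by (simp add: r_def)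
  qed
  ultimately show ?thesis unfolding asymp_approx_in_expectation_def by blast
qed

lemma asymp_approx_sqrt_lnI:
  assumes "0 < C"
    and inst: "\<And>n. sbqp_instance (d n) (\<sigma> n) (P n) (c n)"
    and "\<And>n. sdp_eps_optimal (d n) (\<sigma> n) (c n) (P n) (\<epsilon> n) (W n)"
    and "\<And>n. sbqp_optimal (d n) (\<sigma> n) (P n) (c n) (xopt n)"
    and "(\<lambda>n. real (\<sigma> n) / sqrt (ln (real (d n)))) \<longlonglongrightarrow> 0"
  shows "asymp_approx_in_expectation (\<lambda>n. 1 / ln (real (d n))) P c \<epsilon> xopt
    (\<lambda>n. algorithm1 (W n) C (sqrt (ln (real (d n)))))"
proof -
  have "1 \<le> d n" for n using inst[of n] by (auto simp: sbqp_instance_def)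
  then have nonneg: "0 \<le> ln (real (d n))" for n by simp
  then show ?thesis
    using asymp_approxI[OF assms(1-4) _ assms(5)] by simp
qed

text \<open>The constants 0 and 1 are spelled out so that the bound has the shape of the
  high-probability clause.\<close>

lemma prob_feasible_algorithm1_ge:
  assumes "0 < C" "sbqp_instance d \<sigma> P c" "sdp_eps_optimal d \<sigma> c P \<epsilon> W" "0 \<le> T"
  shows "1 - 0 * (1 / real d) - 1 * exp (- (ln (5 / 4) - 1 / 6) * real \<sigma>)
    \<le> measure (algorithm1 W C T) (sbqp_feasible d \<sigma>)"
proof -
  interpret rounding d \<sigma> P c W C T
    using assms by unfold_locales (auto simp: sdp_eps_optimal_def)
  show ?thesis using prob_feasible_ge by simp
qed

theorem corollary2:
  shows "\<exists>(c0::real) (K1::real) (K2::real). c0 > 0 \<and>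
    (\<forall>(C::real) (d::nat \<Rightarrow> nat) (\<sigma>::nat \<Rightarrow> nat) (P::nat \<Rightarrow> real mat) (c::nat \<Rightarrow> real vec)
       (\<epsilon>::nat \<Rightarrow> real) (W::nat \<Rightarrow> real mat) (xopt::nat \<Rightarrow> real vec).
       0 < C \<and> C \<le> 1 \<and>
       (\<forall>n. sbqp_instance (d n) (\<sigma> n) (P n) (c n)) \<and>
       (\<forall>n. sdp_eps_optimal (d n) (\<sigma> n) (c n) (P n) (\<epsilon> n) (W n)) \<and>
       (\<forall>n. sbqp_optimal (d n) (\<sigma> n) (P n) (c n) (xopt n)) \<and>
       filterlim \<sigma> at_top sequentially
       \<longrightarrow>
       (\<forall>T::real mat \<Rightarrow> real vec \<Rightarrow> real.
          (\<forall>n. T (P n) (c n) > 0) \<and>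
          filterlim (\<lambda>n. T (P n) (c n)) at_top sequentially \<and>
          (\<lambda>n. real (\<sigma> n) / T (P n) (c n)) \<longlonglongrightarrow> 0
          \<longrightarrow>
          asymp_approx_in_expectation (\<lambda>n. 1 / (T (P n) (c n))\<^sup>2) P c \<epsilon> xopt
            (\<lambda>n. algorithm1 (W n) C (T (P n) (c n))) \<and>
          (\<forall>n. measure (algorithm1 (W n) C (T (P n) (c n))) (sbqp_feasible (d n) (\<sigma> n))
                 \<ge> 1 - K1 * (1 / real (d n)) - K2 * exp (- c0 * real (\<sigma> n)))) \<and>
       ((\<lambda>n. real (\<sigma> n) / sqrt (ln (real (d n)))) \<longlonglongrightarrow> 0
          \<longrightarrow>
          asymp_approx_in_expectation (\<lambda>n. 1 / ln (real (d n))) P c \<epsilon> xopt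
            (\<lambda>n. algorithm1 (W n) C (sqrt (ln (real (d n))))) \<and>
          (\<forall>n. measure (algorithm1 (W n) C (sqrt (ln (real (d n))))) (sbqp_feasible (d n) (\<sigma> n))
                 \<ge> 1 - K1 * (1 / real (d n)) - K2 * exp (- c0 * real (\<sigma> n)))))"
\<comment> \<open>The witnesses are the Chernoff exponent of \<open>prob_feasible_ge\<close>,
  coefficient 0 for the term in \<open>1 / d\<close> and coefficient 1 for the exponential.\<close>
proof (rule exI[of _ "ln (5 / 4) - 1 / 6"], rule exI[of _ 0], rule exI[of _ 1],
    intro conjI allI impI; (elim conjE)?)
  \<comment> \<open>This gives \<open>ln (5 / 4) >= 1 / 5 > 1 / 6\<close>; the base 5/4 is thus one
    for which the elementary bound on \<open>ln\<close> already decides the sign.\<close>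
  have "ln (4 / 5) \<le> 4 / 5 - (1::real)" by (rule ln_le_minus_one) simp
  moreover have "ln (4 / 5) = - ln (5 / 4 :: real)" by (simp add: ln_div)
  ultimately show "(0::real) < ln (5 / 4) - 1 / 6" by simp
next
  fix C :: real and d \<sigma> :: "nat \<Rightarrow> nat" and P :: "nat \<Rightarrow> real mat" and c :: "nat \<Rightarrow> real vec"
    and \<epsilon> :: "nat \<Rightarrow> real" and W :: "nat \<Rightarrow> real mat" and xopt :: "nat \<Rightarrow> real vec"
  assume C: "0 < C"
    and inst: "\<forall>n. sbqp_instance (d n) (\<sigma> n) (P n) (c n)"
    and W: "\<forall>n. sdp_eps_optimal (d n) (\<sigma> n) (c n) (P n) (\<epsilon> n) (W n)"
    and opt: "\<forall>n. sbqp_optimal (d n) (\<sigma> n) (P n) (c n) (xopt n)"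
  note prob = prob_feasible_algorithm1_ge[OF C inst[rule_format] W[rule_format]]
  {
    fix T :: "real mat \<Rightarrow> real vec \<Rightarrow> real" and n :: nat
    assume T: "\<forall>n. 0 < T (P n) (c n)" and lim: "(\<lambda>n. real (\<sigma> n) / T (P n) (c n)) \<longlonglongrightarrow> 0"
    show "asymp_approx_in_expectation (\<lambda>n. 1 / (T (P n) (c n))\<^sup>2) P c \<epsilon> xopt
        (\<lambda>n. algorithm1 (W n) C (T (P n) (c n)))"
      using C inst W opt less_imp_le[OF T[rule_format]] lim by (intro asymp_approxI) auto
    show "1 - 0 * (1 / real (d n)) - 1 * exp (- (ln (5 / 4) - 1 / 6) * real (\<sigma> n))
        \<le> measure (algorithm1 (W n) C (T (P n) (c n))) (sbqp_feasible (d n) (\<sigma> n))"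
      using less_imp_le[OF T[rule_format]] by (rule prob)
  next
    fix n :: nat
    assume lim: "(\<lambda>n. real (\<sigma> n) / sqrt (ln (real (d n)))) \<longlonglongrightarrow> 0"
    show "asymp_approx_in_expectation (\<lambda>n. 1 / ln (real (d n))) P c \<epsilon> xopt
        (\<lambda>n. algorithm1 (W n) C (sqrt (ln (real (d n)))))"
      using C inst W opt lim by (intro asymp_approx_sqrt_lnI) auto
    have "1 \<le> d n" using inst by (auto simp: sbqp_instance_def Suc_le_eq elim: less_le_trans)
    then have "0 \<le> sqrt (ln (real (d n)))" by simp
    then show "1 - 0 * (1 / real (d n)) - 1 * exp (- (ln (5 / 4) - 1 / 6) * real (\<sigma> n))
        \<le> measure (algorithm1 (W n) C (sqrt (ln (real (d n))))) (sbqp_feasible (d n) (\<sigma> n))"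
      by (rule prob)
  }
qed

end
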